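(* Let $0\le r\le n$ and let $\mathsf{M}\in\overline{\mathcal{M}}_{r,n}$ be a sparse paving matroid. Then $\mathsf{M}$ is extremal if and only if either $\mathsf{M}$ is the uniform matroid $\mathsf{U}_{r,n}$, or the number of non-bases of $\mathsf{M}$ (i.e. $r$-subsets of $[n]$ that are not bases) is the maximum possible among all sparse paving matroids in $\overline{\mathcal{M}}_{r,n}$.
   Context: A matroid of rank $r$ is paving if every subset of size $r-1$ is independent; it is sparse paving if both it and its dual are paving. For integers $0\le r\le n$, $\overline{\mathcal{M}}_{r,n}$ is the set of matroids with ground set $[n]=\{1,\dots,n\}$ and rank $r$, and $\mathcal{M}_{r,n}$ the set of their isomorphism classes; $[\mathsf{M}]$ is the class of $\mathsf{M}$. The base polytope $\mathscr{P}(\mathsf{M})\subseteq\mathbb{R}^n$ is the convex hull of the $0/1$ indicator vectors of bases; $\mathbf{1}_X$ is the indicator function of $X$. A Schubert matroid is a matroid whose lattice of cyclic flats is a chain; $\overline{\mathcal{S}}_{r,n}$ is the set of Schubert matroids in $\overline{\mathcal{M}}_{r,n}$ and $\mathcal{S}_{r,n}$ the set of their isomorphism classes. For each $\mathsf{M}$ there are unique integers $a_{\mathsf{S}}(\mathsf{M})$ with $\mathbf{1}_{\mathscr{P}(\mathsf{M})}=\sum_{\mathsf{S}\in\overline{\mathcal{S}}_{r,n}}a_{\mathsf{S}}(\mathsf{M})\mathbf{1}_{\mathscr{P}(\mathsf{S})}$. Let $p_{[\mathsf{M}]}\in\mathbb{Z}^{\mathcal{S}_{r,n}}$ have coordinate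 $\sum_{\mathsf{S}\in c}a_{\mathsf{S}}(\mathsf{M})$ at $c\in\mathcal{S}_{r,n}$, and $\Omega_{r,n}=\operatorname{conv}\{p_{[\mathsf{M}]}:[\mathsf{M}]\in\mathcal{M}_{r,n}\}$. The matroid $\mathsf{M}$ is extremal if $p_{[\mathsf{M}]}$ is a vertex of $\Omega_{r,n}$. *)

theory Defs
  imports "HOL-Analysis.Analysis" "HOL-Library.Function_Algebras"
begin

text \<open>
  The pointwise real vector space structure on functions. It gives access to
  \<^term>\<open>convex hull S\<close> and \<^term>\<open>x extreme_point_of S\<close> in coordinate spaces
  whose index set is not a type. The space \<open>\<real>\<^sup>I\<close> is represented by the real functions
  that vanish outside \<open>I\<close>, which form a subspace.
\<close>

instantiation "fun" :: (type, real_vector) real_vector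
begin

definition scaleR_fun_def: "c *\<^sub>R f = (\<lambda>x. c *\<^sub>R f x)"

instance
  by standard (simp_all add: scaleR_fun_def fun_eq_iff scaleR_add_right scaleR_add_left)

end


section \<open>Matroids\<close>

datatype 'a matroid = Matroid (ground: "'a set") (bases: "'a set set")

definition is_matroid :: "'a matroid \<Rightarrow> bool" where
  "is_matroid M \<longleftrightarrow>
     finite (ground M) \<and> bases M \<subseteq> Pow (ground M) \<and> bases M \<noteq> {} \<and>
     (\<forall>A\<in>bases M. \<forall>B\<in>bases M. \<forall>x\<in>A - B. \<exists>y\<in>B - A. insert y (A - {x}) \<in> bases M)"

definition indep :: "'a matroid \<Rightarrow> 'a set \<Rightarrow> bool" where
  "indep M X \<longleftrightarrow> (\<exists>B\<in>bases M. X \<subseteq> B)"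

definition rank_of :: "'a matroid \<Rightarrow> 'a set \<Rightarrow> nat" where
  "rank_of M X = Max (card ` {I. I \<subseteq> X \<and> indep M I})"

definition matroid_rank :: "'a matroid \<Rightarrow> nat" where
  "matroid_rank M = rank_of M (ground M)"

definition dual :: "'a matroid \<Rightarrow> 'a matroid" where
  "dual M = Matroid (ground M) ((\<lambda>B. ground M - B) ` bases M)"

definition circuit :: "'a matroid \<Rightarrow> 'a set \<Rightarrow> bool" where
  "circuit M C \<longleftrightarrow> C \<subseteq> ground M \<and> \<not> indep M C \<and> (\<forall>D. D \<subset> C \<longrightarrow> indep M D)"

definition flat :: "'a matroid \<Rightarrow> 'a set \<Rightarrow> bool" where
  "flat M F \<longleftrightarrow> F \<subseteq> ground M \<and> (\<forall>x\<in>ground M - F. rank_of M F < rank_of M (insert x F))"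

definition cyclic_flats :: "'a matroid \<Rightarrow> 'a set set" where
  "cyclic_flats M = {F. flat M F \<and> (\<exists>\<C>. (\<forall>C\<in>\<C>. circuit M C) \<and> F = \<Union>\<C>)}"

definition schubert :: "'a matroid \<Rightarrow> bool" where
  "schubert M \<longleftrightarrow> is_matroid M \<and>
     (\<forall>F\<in>cyclic_flats M. \<forall>G\<in>cyclic_flats M. F \<subseteq> G \<or> G \<subseteq> F)"

text \<open>The size condition is written additively, so that it is void in rank 0.\<close>

definition paving :: "'a matroid \<Rightarrow> bool" where
  "paving M \<longleftrightarrow> is_matroid M \<and>
     (\<forall>X. X \<subseteq> ground M \<and> card X + 1 = matroid_rank M \<longrightarrow> indep M X)"

definition sparse_paving :: "'a matroid \<Rightarrow> bool" where
  "sparse_paving M \<longleftrightarrow> paving M \<and> paving (dual M)"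

definition isomorphic :: "'a matroid \<Rightarrow> 'a matroid \<Rightarrow> bool" where
  "isomorphic M N \<longleftrightarrow>
     (\<exists>f. bij_betw f (ground M) (ground N) \<and> bases N = (\<lambda>B. f ` B) ` bases M)"


section \<open>Matroids of rank \<open>r\<close> on \<open>{1, \<dots>, n}\<close>\<close>

definition matroids :: "nat \<Rightarrow> nat \<Rightarrow> nat matroid set" where
  "matroids r n = {M. is_matroid M \<and> ground M = {1..n} \<and> matroid_rank M = r}"

definition schuberts :: "nat \<Rightarrow> nat \<Rightarrow> nat matroid set" where
  "schuberts r n = {S \<in> matroids r n. schubert S}"

definition iso_rel :: "nat \<Rightarrow> nat \<Rightarrow> (nat matroid \<times> nat matroid) set" where
  "iso_rel r n = {(M, N). M \<in> matroids r n \<and> N \<in> matroids r n \<and> isomorphic M N}"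

definition schubert_classes :: "nat \<Rightarrow> nat \<Rightarrow> nat matroid set set" where
  "schubert_classes r n = schuberts r n // iso_rel r n"

definition uniform :: "nat \<Rightarrow> nat \<Rightarrow> nat matroid" where
  "uniform r n = Matroid {1..n} {B. B \<subseteq> {1..n} \<and> card B = r}"

definition nonbases :: "nat \<Rightarrow> nat \<Rightarrow> nat matroid \<Rightarrow> nat set set" where
  "nonbases r n M = {X. X \<subseteq> {1..n} \<and> card X = r \<and> X \<notin> bases M}"


section \<open>Schubert expansions and extremality\<close>

definition base_polytope :: "'a matroid \<Rightarrow> ('a \<Rightarrow> real) set" where
  "base_polytope M = convex hull (indicat_real ` bases M)"

text \<open>
  The equation between indicator functions may be read on all of \<^typ>\<open>nat \<Rightarrow> real\<close>,
  because both sides are 0 at points with a nonzero coordinate outside \<open>{1..n}\<close>. The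
  first clause only fixes irrelevant values, so that the coefficients are unique as a function.
\<close>

definition schubert_coeff :: "nat \<Rightarrow> nat \<Rightarrow> nat matroid \<Rightarrow> nat matroid \<Rightarrow> int" where
  "schubert_coeff r n M = (THE a.
     (\<forall>S. S \<notin> schuberts r n \<longrightarrow> a S = 0) \<and>
     (\<forall>x. indicat_real (base_polytope M) x =
        (\<Sum>S\<in>schuberts r n. of_int (a S) * indicat_real (base_polytope S) x)))"

text \<open>
  The point of an isomorphism class, given through a representative; it does not depend
  on the choice, as relabelling the ground set permutes each Schubert class.
\<close>

definition class_point :: "nat \<Rightarrow> nat \<Rightarrow> nat matroid \<Rightarrow> nat matroid set \<Rightarrow> real" where
  "class_point r n M = (\<lambda>c. if c \<in> schubert_classes r n
     then of_int (\<Sum>S\<in>c. schubert_coeff r n M S) else 0)"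

definition Omega :: "nat \<Rightarrow> nat \<Rightarrow> (nat matroid set \<Rightarrow> real) set" where
  "Omega r n = convex hull (class_point r n ` matroids r n)"

definition extremal :: "nat \<Rightarrow> nat \<Rightarrow> nat matroid \<Rightarrow> bool" where
  "extremal r n M \<longleftrightarrow> class_point r n M extreme_point_of Omega r n"

end

theory Submission
  imports Defs
begin

text \<open>
  Evaluating the indicator functions of the base polytopes shows that a sparse paving matroid with
  \<open>\<lambda>\<close> nonbases \<open>H\<close> expands as \<open>(1 - \<lambda>) U + \<Sum>\<^sub>H (U - H)\<close>, where \<open>U - H\<close>
  is the uniform matroid with the basis \<open>H\<close> removed: each nonbasis cuts off one corner of the
  hypersimplex, and these corners are disjoint. So the class points of sparse paving matroids lie on a
  line and depend only on \<open>\<lambda>\<close>, and a value of \<open>\<lambda>\<close> strictly between 0 and the maximum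
  gives no vertex. Conversely, counting the \<open>j\<close>-sets that meet some basis in at least \<open>t\<close>
  elements is a valuation, hence a linear functional of the class point. Counting bases exposes the
  uniform matroid, and a combination of three such counts exposes the maximal sparse paving matroids.

  For the expansions themselves, existence comes from a signed sum over chains of violated rank
  inequalities, whose order complex is empty or a cone, and uniqueness from the Euler
  characteristic of the sections of the base polytopes by half-spaces.
\<close>

section \<open>Rank and independence\<close>

text \<open>Base polytopes are hulls of basis indicators, whereas indicator functions can be
  evaluated pointwise only through inequalities; hence an integrality theorem is needed. It is
  stated for integer caps on a family whose tight members uncross, so that one argument serves both
  a whole rank function and a chain of caps.

  The coefficients are defined by a description operator, so nothing can be said of them before
  existence and uniqueness are settled. One valuation does double duty: cutting a polytope by the
  half-space \<open>w \<cdot> x \<ge> t\<close> and taking the Euler characteristic records whether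
  some basis has weight at least \<open>t\<close>. With digit weights this separates Schubert
  matroids; with \<open>w\<close> the indicator of a set \<open>X\<close> it records whether
  \<open>X\<close> has rank at least \<open>t\<close>.

  A class point forgets labels, so only isomorphism-invariant valuations factor through it; summing
  over all \<open>X\<close> of one size achieves this. The sizes \<open>r - 1\<close> and
  \<open>r + 1\<close> test the two halves of sparse paving, since paving of the dual says that
  every set of size \<open>r + 1\<close> contains a basis.\<close>

lemma card_exchange:
  assumes "finite A" "x \<in> A" "y \<notin> A"
  shows "card (insert y (A - {x})) = card A"
  using assms card_Suc_Diff1[OF assms(1,2)] by simp

locale base_matroid =
  fixes M :: "'a matroid"
  assumes matroid: "is_matroid M"
begin

lemma finite_ground: "finite (ground M)"
  and basis_subset: "B \<in> bases M \<Longrightarrow> B \<subseteq> ground M"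
  and bases_nonempty: "bases M \<noteq> {}"
  using matroid by (auto simp: is_matroid_def)

lemma basis_exchange:
  "\<lbrakk>A \<in> bases M; B \<in> bases M; x \<in> A - B\<rbrakk> \<Longrightarrow> \<exists>y\<in>B - A. insert y (A - {x}) \<in> bases M"
  using matroid unfolding is_matroid_def by blast

lemma finite_basis: "B \<in> bases M \<Longrightarrow> finite B"
  using basis_subset finite_ground finite_subset by blast

lemma indep_subset_ground: "indep M I \<Longrightarrow> I \<subseteq> ground M"
  unfolding indep_def using basis_subset by blast

lemma finite_indep: "indep M I \<Longrightarrow> finite I"
  using indep_subset_ground finite_ground finite_subset by blast

lemma indep_subset: "indep M I \<Longrightarrow> J \<subseteq> I \<Longrightarrow> indep M J"
  unfolding indep_def by blast

lemma indep_empty: "indep M {}"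
  unfolding indep_def using bases_nonempty by blast

lemma indep_basis: "B \<in> bases M \<Longrightarrow> indep M B"
  unfolding indep_def by blast

text \<open>Exchanging an element of \<open>A - B\<close> for one of \<open>B - A\<close> keeps the
  size and shrinks \<open>A - B\<close>. Once \<open>A \<subseteq> B\<close>, an extra element of
  \<open>B\<close> could not be exchanged, as \<open>A - B\<close> is empty.\<close>

lemma card_bases_eq:
  assumes "A \<in> bases M" "B \<in> bases M"
  shows "card A = card B"
  using assms(1)
proof (induction "card (A - B)" arbitrary: A)
  case 0
  then have "A \<subseteq> B" using finite_basis by auto
  moreover have "B \<subseteq> A"
  proof
    fix y assume "y \<in> B"
    then show "y \<in> A"
      using basis_exchange[OF assms(2) 0(2), of y] \<open>A \<subseteq> B\<close> by blast
  qed
  ultimately show ?case by simp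
next
  case (Suc k)
  from Suc(2) obtain x where x: "x \<in> A - B" by (metis card.empty nat.distinct(1) ex_in_conv)
  then obtain y where y: "y \<in> B - A" "insert y (A - {x}) \<in> bases M"
    using basis_exchange[OF Suc(3) assms(2)] by blast
  have fin: "finite A" using Suc finite_basis by simp
  have "insert y (A - {x}) - B = (A - B) - {x}" using y by auto
  then have "k = card (insert y (A - {x}) - B)"
    using Suc(2) x fin by simp
  then have "card (insert y (A - {x})) = card B" using Suc(1) y by blast
  moreover have "card (insert y (A - {x})) = card A"
    using x y fin by (intro card_exchange) auto
  ultimately show ?case by simp
qed

text \<open>Take any basis containing \<open>I\<close> and exchange its elements outside
  \<open>I \<union> B\<close> one by one for elements of \<open>B\<close>; members of
  \<open>I\<close> are never removed.\<close>

lemma indep_extend_by_basis: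
  assumes "indep M I" "B \<in> bases M"
  shows "\<exists>D\<in>bases M. I \<subseteq> D \<and> D \<subseteq> I \<union> B"
proof -
  have "\<exists>D\<in>bases M. I \<subseteq> D \<and> D \<subseteq> I \<union> B" if "A \<in> bases M" "I \<subseteq> A" for A
    using that
  proof (induction "card (A - (I \<union> B))" arbitrary: A)
    case 0
    then have "A - (I \<union> B) = {}" using finite_basis[OF 0(2)] by simp
    then show ?case using 0 by blast
  next
    case (Suc k)
    from Suc(2) obtain x where x: "x \<in> A - (I \<union> B)" by (metis card.empty nat.distinct(1) ex_in_conv)
    then obtain y where y: "y \<in> B - A" "insert y (A - {x}) \<in> bases M"
      using basis_exchange[OF Suc(3) assms(2), of x] by blast
    have fin: "finite A" using Suc finite_basis by simp
    have "insert y (A - {x}) - (I \<union> B) = (A - (I \<union> B)) - {x}" using y by auto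
    then have "k = card (insert y (A - {x}) - (I \<union> B))"
      using Suc(2) x fin by simp
    then show ?case using Suc(1)[of "insert y (A - {x})"] y x Suc(4) by blast
  qed
  then show ?thesis using assms(1) unfolding indep_def by blast
qed

text \<open>A basis \<open>D\<close> with \<open>I \<subseteq> D \<subseteq> I \<union> B\<close>,
  where \<open>B\<close> extends \<open>J\<close>, has to use an element of \<open>J - I\<close>:
  otherwise \<open>D\<close> lies in \<open>I \<union> (B - J)\<close>, which is smaller than a
  basis.\<close>

lemma augment:
  assumes "indep M I" "indep M J" "card I < card J"
  shows "\<exists>y\<in>J - I. indep M (insert y I)"
proof (rule ccontr)
  assume neg: "\<not> ?thesis"
  obtain B where B: "B \<in> bases M" "J \<subseteq> B" using assms(2) unfolding indep_def by blast
  obtain D where D: "D \<in> bases M" "I \<subseteq> D" "D \<subseteq> I \<union> B"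
    using indep_extend_by_basis[OF assms(1) B(1)] by blast
  have fin: "finite I" "finite B" "finite J"
    using assms finite_indep finite_basis B by auto
  have "y \<notin> D" if "y \<in> J - I" for y
  proof
    assume "y \<in> D"
    then have "indep M (insert y I)" using D unfolding indep_def by blast
    then show False using neg that by blast
  qed
  then have "D \<subseteq> I \<union> (B - J)" using D by blast
  then have "card D \<le> card I + card (B - J)"
    by (meson fin card_Un_le card_mono finite_Diff finite_Un le_trans)
  also have "card (B - J) = card B - card J" using fin B card_Diff_subset by blast
  finally have "card D < card B"
    using assms(3) card_mono[OF fin(2) B(2)] by linarith
  then show False using card_bases_eq[OF D(1) B(1)] by simp
qed

section \<open>The rank function\<close>

lemma finite_indep_cards: "finite (card ` {I. I \<subseteq> X \<and> indep M I})"
  by (rule finite_imageI, rule finite_subset[of _ "Pow (ground M)"])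
    (use indep_subset_ground finite_ground in auto)

lemma card_le_rank: "I \<subseteq> X \<Longrightarrow> indep M I \<Longrightarrow> card I \<le> rank_of M X"
  unfolding rank_of_def by (rule Max_ge[OF finite_indep_cards]) auto

lemma rank_witness: "\<exists>I. I \<subseteq> X \<and> indep M I \<and> card I = rank_of M X"
proof -
  have "card ` {I. I \<subseteq> X \<and> indep M I} \<noteq> {}"
    using indep_empty by blast
  from Max_in[OF finite_indep_cards this] obtain I
    where "Max (card ` {I. I \<subseteq> X \<and> indep M I}) = card I" "I \<in> {I. I \<subseteq> X \<and> indep M I}"
    by (rule imageE)
  then show ?thesis unfolding rank_of_def by auto
qed

lemma rank_le:
  assumes "\<And>I. I \<subseteq> X \<Longrightarrow> indep M I \<Longrightarrow> card I \<le> k"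
  shows "rank_of M X \<le> k"
proof -
  obtain I where "I \<subseteq> X" "indep M I" "card I = rank_of M X" using rank_witness by blast
  then show ?thesis using assms[of I] by simp
qed

lemma rank_mono: "X \<subseteq> Y \<Longrightarrow> rank_of M X \<le> rank_of M Y"
  by (rule rank_le, rule card_le_rank) auto

lemma rank_le_card: "finite X \<Longrightarrow> rank_of M X \<le> card X"
  by (rule rank_le, rule card_mono)

lemma rank_indep: "indep M I \<Longrightarrow> rank_of M I = card I"
  using rank_le_card[OF finite_indep] card_le_rank[OF order_refl] by (simp add: le_antisym)

lemma indep_iff_rank: "finite X \<Longrightarrow> indep M X \<longleftrightarrow> card X \<le> rank_of M X"
proof
  assume "finite X" "card X \<le> rank_of M X"
  moreover obtain I where "I \<subseteq> X" "indep M I" "card I = rank_of M X" using rank_witness by blast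
  ultimately show "indep M X" using card_seteq by metis
qed (simp add: rank_indep)

lemma card_basis: "B \<in> bases M \<Longrightarrow> card B = matroid_rank M"
proof -
  assume B: "B \<in> bases M"
  have "rank_of M (ground M) \<le> card B"
  proof (rule rank_le)
    fix I assume "indep M I"
    then obtain D where "D \<in> bases M" "I \<subseteq> D" unfolding indep_def by blast
    then have "card I \<le> card D" using finite_basis by (intro card_mono) auto
    then show "card I \<le> card B" using card_bases_eq[OF \<open>D \<in> bases M\<close> B] by simp
  qed
  moreover have "card B \<le> rank_of M (ground M)"
    by (rule card_le_rank[OF basis_subset[OF B] indep_basis[OF B]])
  ultimately show ?thesis by (simp add: matroid_rank_def)
qed

lemma rank_le_matroid_rank: "rank_of M X \<le> matroid_rank M"
proof (rule rank_le)
  fix I assume "indep M I"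
  then show "card I \<le> matroid_rank M"
    unfolding matroid_rank_def by (intro card_le_rank indep_subset_ground)
qed

lemma basis_iff_indep: "B \<in> bases M \<longleftrightarrow> indep M B \<and> card B = matroid_rank M"
proof
  assume *: "indep M B \<and> card B = matroid_rank M"
  then obtain D where D: "D \<in> bases M" "B \<subseteq> D" unfolding indep_def by blast
  then have "B = D" using card_basis[OF D(1)] * finite_basis[OF D(1)] by (simp add: card_subset_eq)
  then show "B \<in> bases M" using D by simp
qed (use indep_basis card_basis in auto)

lemma indep_extend:
  assumes "indep M I" "I \<subseteq> X"
  shows "\<exists>J. I \<subseteq> J \<and> J \<subseteq> X \<and> indep M J \<and> card J = rank_of M X"
  using assms
proof (induction "rank_of M X - card I" arbitrary: I)
  case 0
  then show ?case using card_le_rank[OF 0(3,2)] by (intro exI[of _ I]) auto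
next
  case (Suc k)
  obtain J where J: "J \<subseteq> X" "indep M J" "card J = rank_of M X" using rank_witness by blast
  obtain y where y: "y \<in> J - I" "indep M (insert y I)"
    using augment[OF Suc(3) J(2)] Suc(2) J(3) by force
  have "card (insert y I) = Suc (card I)" using y finite_indep[OF Suc(3)] by simp
  then have "k = rank_of M X - card (insert y I)" using Suc(2) by simp
  then show ?case using Suc(1)[of "insert y I"] y J Suc(4) by auto
qed

lemma indep_extend_basis:
  assumes "indep M I" shows "\<exists>B\<in>bases M. I \<subseteq> B"
  using assms unfolding indep_def by blast

lemma card_basis_Int_le: "B \<in> bases M \<Longrightarrow> card (B \<inter> X) \<le> rank_of M X"
  by (rule card_le_rank) (auto intro: indep_subset[OF indep_basis])

text \<open>Greedy construction: a maximal independent subset of each member is extended inside the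
  next larger one, so one basis attains the rank of the whole chain simultaneously. It yields
  submodularity and, later, the maximum of a weight built from nested sets.\<close>

lemma chain_adapted_basis:
  assumes "finite \<C>" "\<And>Y Z. Y \<in> \<C> \<Longrightarrow> Z \<in> \<C> \<Longrightarrow> Y \<subseteq> Z \<or> Z \<subseteq> Y" "\<And>Z. Z \<in> \<C> \<Longrightarrow> Z \<subseteq> ground M"
  shows "\<exists>B\<in>bases M. \<forall>Z\<in>\<C>. card (B \<inter> Z) = rank_of M Z"
proof -
  have "\<exists>I. indep M I \<and> I \<subseteq> \<Union>\<C> \<and> (\<forall>Z\<in>\<C>. card (I \<inter> Z) = rank_of M Z)"
    using assms
  proof (induction \<C> rule: finite_ranking_induct[where f = card])
    case empty
    show ?case using indep_empty by blast
  next
    case (insert Z \<C>)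
    then obtain I where I: "indep M I" "I \<subseteq> \<Union>\<C>" "\<And>Y. Y \<in> \<C> \<Longrightarrow> card (I \<inter> Y) = rank_of M Y"
      by (metis insertCI)
    \<comment> \<open>The ranking induction inserts members by increasing size, so in a chain the
      new member contains all earlier ones.\<close>
    have sub: "Y \<subseteq> Z" if "Y \<in> \<C>" for Y
    proof -
      have "Y \<subseteq> Z \<or> Z \<subseteq> Y" "card Y \<le> card Z"
        using insert that by auto
      moreover have "finite Y"
        using insert.prems(2)[of Y] that finite_ground by (auto intro: finite_subset)
      ultimately show ?thesis using card_seteq[of Y Z] by blast
    qed
    then have "I \<subseteq> Z" using I by blast
    then obtain J where J: "I \<subseteq> J" "J \<subseteq> Z" "indep M J" "card J = rank_of M Z"
      using indep_extend[OF I(1)] by blast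
    have "card (J \<inter> Y) = rank_of M Y" if "Y \<in> insert Z \<C>" for Y
    proof (cases "Y = Z")
      case True
      then show ?thesis using J by (simp add: Int_absorb2)
    next
      case False
      then have "card (I \<inter> Y) = rank_of M Y" using I that by blast
      moreover have "card (I \<inter> Y) \<le> card (J \<inter> Y)"
        using J(1) finite_indep[OF J(3)] by (intro card_mono) auto
      moreover have "card (J \<inter> Y) \<le> rank_of M Y"
        by (rule card_le_rank) (auto intro: indep_subset[OF J(3)])
      ultimately show ?thesis by linarith
    qed
    then show ?case using J by blast
  qed
  then obtain I where I: "indep M I" "\<forall>Z\<in>\<C>. card (I \<inter> Z) = rank_of M Z" by blast
  obtain B where B: "B \<in> bases M" "I \<subseteq> B" using indep_extend_basis[OF I(1)] by blast
  have "card (B \<inter> Z) = rank_of M Z" if "Z \<in> \<C>" for Z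
  proof -
    have "card (I \<inter> Z) \<le> card (B \<inter> Z)" using B finite_basis by (intro card_mono) auto
    then show ?thesis using I(2) that card_basis_Int_le[OF B(1), of Z] by force
  qed
  then show ?thesis using B by blast
qed

text \<open>A basis adapted to \<open>X \<inter> Y \<subseteq> X \<union> Y\<close> attains both
  ranks on the left; on \<open>X\<close> and \<open>Y\<close> it stays below the rank, and
  cardinalities are modular.\<close>

lemma rank_submodular:
  assumes "X \<subseteq> ground M" "Y \<subseteq> ground M"
  shows "rank_of M (X \<union> Y) + rank_of M (X \<inter> Y) \<le> rank_of M X + rank_of M Y"
proof -
  obtain B where B: "B \<in> bases M" "\<forall>Z\<in>{X \<inter> Y, X \<union> Y}. card (B \<inter> Z) = rank_of M Z"
    using chain_adapted_basis[of "{X \<inter> Y, X \<union> Y}"] assms by auto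
  have "card (B \<inter> X) + card (B \<inter> Y) = card ((B \<inter> X) \<union> (B \<inter> Y)) + card ((B \<inter> X) \<inter> (B \<inter> Y))"
    using B finite_basis by (intro card_Un_Int) auto
  also have "(B \<inter> X) \<union> (B \<inter> Y) = B \<inter> (X \<union> Y)" by auto
  also have "(B \<inter> X) \<inter> (B \<inter> Y) = B \<inter> (X \<inter> Y)" by auto
  finally show ?thesis
    using B(2) card_basis_Int_le[OF B(1), of X] card_basis_Int_le[OF B(1), of Y] by simp
qed

lemma rank_union_same:
  assumes "X \<subseteq> ground M" "finite Y" "Y \<subseteq> ground M" "\<And>y. y \<in> Y \<Longrightarrow> rank_of M (insert y X) = rank_of M X"
  shows "rank_of M (X \<union> Y) = rank_of M X"
  using assms(2-4)
proof (induction Y rule: finite_induct)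
  case (insert y Y)
  have eq: "(X \<union> Y) \<union> insert y X = X \<union> insert y Y" by auto
  have "rank_of M (X \<union> insert y Y) + rank_of M ((X \<union> Y) \<inter> insert y X)
      \<le> rank_of M (X \<union> Y) + rank_of M (insert y X)"
    using rank_submodular[of "X \<union> Y" "insert y X"] assms(1) insert.prems unfolding eq by auto
  moreover have "rank_of M X \<le> rank_of M ((X \<union> Y) \<inter> insert y X)" by (rule rank_mono) auto
  moreover have "rank_of M (X \<union> Y) = rank_of M X" using insert by auto
  moreover have "rank_of M (insert y X) = rank_of M X" using insert.prems by auto
  moreover have "rank_of M X \<le> rank_of M (X \<union> insert y Y)" by (rule rank_mono) auto
  ultimately show ?case by simp
qed simp

section \<open>Circuits and cyclic flats\<close>

lemma circuit_exists:
  assumes "X \<subseteq> ground M" "\<not> indep M X"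
  shows "\<exists>C\<subseteq>X. circuit M C"
proof -
  have "finite X" using assms finite_ground finite_subset by blast
  then show ?thesis using assms
  proof (induction X rule: finite_psubset_induct)
    case (psubset X)
    show ?case
    proof (cases "\<exists>D. D \<subset> X \<and> \<not> indep M D")
      case True
      then show ?thesis using psubset by (meson psubset_imp_subset subset_trans)
    next
      case False
      then show ?thesis using psubset unfolding circuit_def by blast
    qed
  qed
qed

lemma rank_circuit:
  assumes "circuit M C"
  shows "rank_of M C < card C"
proof -
  have "finite C" using assms finite_ground finite_subset unfolding circuit_def by blast
  then show ?thesis using assms indep_iff_rank unfolding circuit_def by force
qed

text \<open>The closure of a circuit is a cyclic flat, so dependence is always witnessed by a cyclic flat.\<close>

lemma circuit_in_cyclic_flat:
  assumes C: "circuit M C"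
  shows "\<exists>F\<in>cyclic_flats M. C \<subseteq> F \<and> rank_of M F < card C"
proof -
  define F where "F = {x \<in> ground M. rank_of M (insert x C) = rank_of M C}"
  have Cg: "C \<subseteq> ground M" using C unfolding circuit_def by blast
  have CF: "C \<subseteq> F" using Cg by (auto simp: F_def insert_absorb)
  have finF: "finite F" "F \<subseteq> ground M" unfolding F_def using finite_ground by auto
  have finC: "finite C" using CF finF finite_subset by blast
  have "rank_of M (C \<union> F) = rank_of M C"
    using rank_union_same[OF Cg finF] unfolding F_def by blast
  then have rF: "rank_of M F = rank_of M C" using CF by (simp add: Un_absorb1)
  have "flat M F"
    unfolding flat_def
  proof (intro conjI ballI)
    fix x assume x: "x \<in> ground M - F"
    then have "rank_of M (insert x C) \<noteq> rank_of M C" unfolding F_def by auto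
    moreover have "rank_of M C \<le> rank_of M (insert x C)" by (rule rank_mono) auto
    moreover have "rank_of M (insert x C) \<le> rank_of M (insert x F)"
      using CF by (intro rank_mono) auto
    ultimately show "rank_of M F < rank_of M (insert x F)" using rF by linarith
  qed (rule finF)
  have cover: "\<exists>D. circuit M D \<and> x \<in> D \<and> D \<subseteq> F" if "x \<in> F" for x
  proof (cases "x \<in> C")
    case True
    then show ?thesis using C CF by blast
  next
    case False
    \<comment> \<open>Adding \<open>x\<close> to a maximal independent subset of \<open>C\<close>
      does not raise the rank, hence creates a circuit; it passes through \<open>x\<close> because
      \<open>I\<close> is independent.\<close>
    obtain I where I: "I \<subseteq> C" "indep M I" "card I = rank_of M C" using rank_witness by blast
    have "\<not> indep M (insert x I)"
    proof
      assume "indep M (insert x I)"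
      then have "card (insert x I) \<le> rank_of M (insert x C)" using I by (intro card_le_rank) auto
      moreover have "x \<notin> I" using False I by blast
      ultimately show False using I that finite_indep[OF I(2)] unfolding F_def by simp
    qed
    moreover have "insert x I \<subseteq> ground M" using that finF(2) I(1) Cg by blast
    ultimately obtain D where D: "D \<subseteq> insert x I" "circuit M D"
      using circuit_exists by blast
    moreover have "x \<in> D"
    proof (rule ccontr)
      assume "x \<notin> D"
      then have "D \<subseteq> I" using D by blast
      then have "indep M D" by (rule indep_subset[OF I(2)])
      then show False using D unfolding circuit_def by blast
    qed
    moreover have "D \<subseteq> F" using D(1) I(1) CF that by blast
    ultimately show ?thesis using D(2) by blast
  qed
  have "F \<subseteq> \<Union>{D. circuit M D \<and> D \<subseteq> F}"
  proof
    fix x assume "x \<in> F"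
    from cover[OF this] obtain D where "circuit M D" "x \<in> D" "D \<subseteq> F" by blast
    then show "x \<in> \<Union>{D. circuit M D \<and> D \<subseteq> F}" by simp blast
  qed
  moreover have "\<Union>{D. circuit M D \<and> D \<subseteq> F} \<subseteq> F" by blast
  ultimately have "F = \<Union>{D. circuit M D \<and> D \<subseteq> F}" by (rule equalityI)
  then have "\<exists>\<C>. (\<forall>D\<in>\<C>. circuit M D) \<and> F = \<Union>\<C>"
    by (intro exI[of _ "{D. circuit M D \<and> D \<subseteq> F}"]) auto
  with \<open>flat M F\<close> have "F \<in> cyclic_flats M" unfolding cyclic_flats_def by simp
  then show ?thesis using CF rF rank_circuit[OF C] by auto
qed

text \<open>A dependent set contains a circuit, and the cyclic flat around that circuit would be
  overfilled. So the cyclic flats and their ranks determine the bases, which lets a Schubert matroid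
  be recovered from its chain.\<close>

lemma basis_if_cyclic_flats:
  assumes "B \<subseteq> ground M" "card B = matroid_rank M"
    and "\<And>Z. Z \<in> cyclic_flats M \<Longrightarrow> card (B \<inter> Z) \<le> rank_of M Z"
  shows "B \<in> bases M"
proof -
  have "indep M B"
  proof (rule ccontr)
    assume "\<not> indep M B"
    then obtain C where C: "C \<subseteq> B" "circuit M C"
      using circuit_exists[OF assms(1)] by blast
    then obtain F where F: "F \<in> cyclic_flats M" "C \<subseteq> F" "rank_of M F < card C"
      using circuit_in_cyclic_flat by blast
    have "card C \<le> card (B \<inter> F)"
      using C F assms(1) finite_ground by (intro card_mono) (auto intro: finite_subset)
    then show False using assms(3)[OF F(1)] F(3) by linarith
  qed
  then show ?thesis using basis_iff_indep assms by blast
qed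

lemma cyclic_flats_subset: "Z \<in> cyclic_flats M \<Longrightarrow> Z \<subseteq> ground M"
  unfolding cyclic_flats_def flat_def by blast

text \<open>Dual exchange needs a basis that gains the prescribed \<open>x\<close> and loses some
  \<open>y\<close> outside \<open>B\<close>. Extending \<open>insert x (A \<inter> B)\<close> inside
  \<open>insert x A\<close> gives one: by size it misses exactly one element of \<open>A\<close>,
  and that element is not in \<open>B\<close>.\<close>

lemma dual_is_matroid: "is_matroid (dual M)"
  unfolding is_matroid_def
proof (intro conjI ballI)
  show "finite (ground (dual M))" using finite_ground by (simp add: dual_def)
  show "bases (dual M) \<subseteq> Pow (ground (dual M))" by (auto simp: dual_def)
  show "bases (dual M) \<noteq> {}" using bases_nonempty by (simp add: dual_def)
  fix A' B' x assume "A' \<in> bases (dual M)" "B' \<in> bases (dual M)" and x: "x \<in> A' - B'"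
  then obtain A B where A: "A \<in> bases M" "A' = ground M - A" and B: "B \<in> bases M" "B' = ground M - B"
    by (auto simp: dual_def)
  have x': "x \<in> B" "x \<notin> A" "x \<in> ground M" using x A B by auto
  have "indep M (insert x (A \<inter> B))"
    by (rule indep_subset[OF indep_basis[OF B(1)]]) (use x' in auto)
  then obtain D where D: "D \<in> bases M" "insert x (A \<inter> B) \<subseteq> D" "D \<subseteq> insert x (A \<inter> B) \<union> A"
    using indep_extend_by_basis[OF _ A(1)] by metis
  have fin: "finite A" "finite D" using finite_basis[OF A(1)] finite_basis[OF D(1)] by auto
  have cD: "card D = card A" by (rule card_bases_eq[OF D(1) A(1)])
  have DA: "D \<subseteq> insert x A" using D by blast
  have xD: "x \<in> D" using D by blast
  have "\<not> A \<subseteq> D"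
  proof
    assume "A \<subseteq> D"
    then have "A = D" using card_subset_eq[OF fin(2)] cD by simp
    then show False using xD x' by blast
  qed
  then obtain y where y: "y \<in> A" "y \<notin> D" by blast
  have "D \<subseteq> insert x (A - {y})" using DA y by blast
  moreover have "card (insert x (A - {y})) = card D"
    using card_exchange[OF fin(1) y(1) x'(2)] cD by simp
  ultimately have eq: "D = insert x (A - {y})"
    using fin by (intro card_subset_eq) auto
  have "y \<notin> B" using y D(2) by blast
  then have "y \<in> B' - A'" using y A B basis_subset[OF A(1)] by blast
  moreover have "insert y (A' - {x}) = ground M - D"
    using eq A y x' basis_subset[OF A(1)] by blast
  then have "insert y (A' - {x}) \<in> bases (dual M)" using D by (auto simp: dual_def)
  ultimately show "\<exists>y\<in>B' - A'. insert y (A' - {x}) \<in> bases (dual M)" by blast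
qed

end

section \<open>Integrality of capped hypersimplices\<close>

definition hypersimplex :: "'a set \<Rightarrow> nat \<Rightarrow> ('a \<Rightarrow> real) set" where
  "hypersimplex E r =
     {x. (\<forall>e. e \<notin> E \<longrightarrow> x e = 0) \<and> (\<forall>e. 0 \<le> x e \<and> x e \<le> 1) \<and> sum x E = real r}"

definition capped_polytope ::
    "'a set \<Rightarrow> nat \<Rightarrow> 'a set set \<Rightarrow> ('a set \<Rightarrow> nat) \<Rightarrow> ('a \<Rightarrow> real) set" where
  "capped_polytope E r \<F> f = {x \<in> hypersimplex E r. \<forall>A\<in>\<F>. sum x A \<le> real (f A)}"

lemma sum_indicat_real: "finite A \<Longrightarrow> sum (indicat_real B) A = real (card (B \<inter> A))"
  by (simp add: indicator_def sum.If_cases Int_commute)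

lemma sum_scaleR_plus:
  fixes x y :: "'a \<Rightarrow> real"
  shows "sum (u *\<^sub>R x + v *\<^sub>R y) A = u * sum x A + v * sum y A"
  by (simp add: scaleR_fun_def sum.distrib sum_distrib_left)

lemma convex_hypersimplex: "convex (hypersimplex E r)"
proof (rule convexI)
  fix x y and u v :: real
  assume *: "x \<in> hypersimplex E r" "y \<in> hypersimplex E r" "0 \<le> u" "0 \<le> v" "u + v = 1"
  have "0 \<le> (u *\<^sub>R x + v *\<^sub>R y) e \<and> (u *\<^sub>R x + v *\<^sub>R y) e \<le> 1" for e
  proof -
    have xy: "0 \<le> x e" "x e \<le> 1" "0 \<le> y e" "y e \<le> 1" using * by (auto simp: hypersimplex_def)
    then have "u * x e + v * y e \<le> 1" using *(3-5) by (intro convex_bound_le) auto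
    then show ?thesis using xy * by (simp add: scaleR_fun_def)
  qed
  moreover have "sum (u *\<^sub>R x + v *\<^sub>R y) E = real r"
    using * unfolding sum_scaleR_plus by (simp add: hypersimplex_def flip: distrib_right)
  moreover have "(u *\<^sub>R x + v *\<^sub>R y) e = 0" if "e \<notin> E" for e
    using * that by (simp add: hypersimplex_def scaleR_fun_def)
  ultimately show "u *\<^sub>R x + v *\<^sub>R y \<in> hypersimplex E r"
    unfolding hypersimplex_def by blast
qed

lemma convex_sum_le:
  fixes c :: real
  shows "convex {x. sum x A \<le> c}"
proof (rule convexI)
  fix x y :: "'a \<Rightarrow> real" and u v :: real
  assume "x \<in> {x. sum x A \<le> c}" "y \<in> {x. sum x A \<le> c}" "0 \<le> u" "0 \<le> v" "u + v = 1"
  then show "u *\<^sub>R x + v *\<^sub>R y \<in> {x. sum x A \<le> c}"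
    unfolding sum_scaleR_plus mem_Collect_eq by (intro convex_bound_le)
qed

lemma convex_capped_polytope: "convex (capped_polytope E r \<F> f)"
proof -
  have "capped_polytope E r \<F> f = hypersimplex E r \<inter> (\<Inter>A\<in>\<F>. {x. sum x A \<le> real (f A)})"
    by (auto simp: capped_polytope_def)
  then show ?thesis
    by (simp add: convex_Int convex_hypersimplex convex_INT convex_sum_le)
qed

lemma integral_point:
  assumes "v \<in> hypersimplex E r" "\<forall>e. v e = 0 \<or> v e = 1"
  obtains B where "B \<subseteq> E" "v = indicat_real B"
proof
  show "{e. v e = 1} \<subseteq> E" using assms unfolding hypersimplex_def by force
  show "v = indicat_real {e. v e = 1}"
    using assms(2) by (auto simp: fun_eq_iff indicator_def)
qed

lemma indicator_in_hypersimplex: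
  assumes "finite E"
  shows "indicat_real B \<in> hypersimplex E r \<longleftrightarrow> B \<subseteq> E \<and> card B = r"
proof -
  have "(\<forall>e. e \<notin> E \<longrightarrow> indicat_real B e = 0) \<longleftrightarrow> B \<subseteq> E"
    by (auto simp: indicator_def)
  moreover have "B \<subseteq> E \<Longrightarrow> B \<inter> E = B" by blast
  ultimately show ?thesis
    unfolding hypersimplex_def mem_Collect_eq sum_indicat_real[OF assms]
    by (auto simp: indicator_def)
qed

lemma indicator_in_capped_polytope:
  assumes "finite E" "\<F> \<subseteq> Pow E"
  shows "indicat_real B \<in> capped_polytope E r \<F> f \<longleftrightarrow>
    B \<subseteq> E \<and> card B = r \<and> (\<forall>A\<in>\<F>. card (B \<inter> A) \<le> f A)"
proof -
  have "finite A" if "A \<in> \<F>" for A using that assms finite_subset by blast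
  then show ?thesis
    unfolding capped_polytope_def using indicator_in_hypersimplex[OF assms(1)]
    by (auto simp: sum_indicat_real)
qed

text \<open>Uncrossing is assumed only for sets tight at a common point. For all subsets with a rank
  function it follows from submodularity; for a chain of caps it is immediate. Having
  \<open>E\<close> with cap \<open>r\<close> in the family guarantees a tight set around every
  fractional coordinate.\<close>

locale cap_family =
  fixes E :: "'a set" and r :: nat and \<F> :: "'a set set" and f :: "'a set \<Rightarrow> nat"
  assumes finite_E: "finite E"
    and family_subset: "\<F> \<subseteq> Pow E"
    and E_in_family: "E \<in> \<F>" and cap_E: "f E = r"
    and tight_Int: "\<lbrakk>x \<in> capped_polytope E r \<F> f; A \<in> \<F>; B \<in> \<F>; sum x A = f A; sum x B = f B\<rbrakk>
      \<Longrightarrow> A \<inter> B \<in> \<F> \<and> sum x (A \<inter> B) = f (A \<inter> B)"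
begin

abbreviation "P \<equiv> capped_polytope E r \<F> f"

definition fractional :: "('a \<Rightarrow> real) \<Rightarrow> 'a set" where
  "fractional x = {e \<in> E. x e \<noteq> 0 \<and> x e \<noteq> 1}"

definition slack :: "('a \<Rightarrow> real) \<Rightarrow> 'a set set" where
  "slack x = {A \<in> \<F>. sum x A \<noteq> f A}"

text \<open>Induction measure for moving a point towards a vertex: every move makes a coordinate
  integral or a cap tight and undoes neither.\<close>

definition defect :: "('a \<Rightarrow> real) \<Rightarrow> nat" where
  "defect x = card (fractional x) + card (slack x)"

lemma finite_family: "finite \<F>"
  using finite_E family_subset finite_subset by blast

lemma finite_member: "A \<in> \<F> \<Longrightarrow> finite A"
  using finite_E family_subset finite_subset by blast

text \<open>Mass goes from \<open>j\<close> to \<open>i\<close>. Only caps on sets with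
  \<open>i\<close> but not \<open>j\<close> can become violated, and none of these is tight, so a
  positive step is possible; tight sets contain both or neither and stay tight.\<close>

lemma shift:
  assumes x: "x \<in> P" and ij: "i \<in> fractional x" "j \<in> fractional x" "i \<noteq> j"
    and unseparated: "\<And>A. A \<in> \<F> \<Longrightarrow> sum x A = f A \<Longrightarrow> i \<in> A \<longleftrightarrow> j \<in> A"
  obtains t where "t > 0" "(\<lambda>e. x e + t * (of_bool (e = i) - of_bool (e = j))) \<in> P"
    "defect (\<lambda>e. x e + t * (of_bool (e = i) - of_bool (e = j))) < defect x"
proof -
  define \<A> where "\<A> = {A \<in> \<F>. i \<in> A \<and> j \<notin> A}"
  \<comment> \<open>The three events that stop the move: coordinate \<open>i\<close> reaches 1,
    coordinate \<open>j\<close> reaches 0, or the cap on a set of \<open>\<A>\<close> becomes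
    tight.\<close>
  define T where "T = insert (1 - x i) (insert (x j) ((\<lambda>A. f A - sum x A) ` \<A>))"
  define t where "t = Min T"
  define y where "y = (\<lambda>e. x e + t * (of_bool (e = i) - of_bool (e = j)))"
  have finT: "finite T" unfolding T_def \<A>_def using finite_family by simp
  have tT: "t \<in> T" unfolding t_def using finT by (intro Min_in) (auto simp: T_def)
  have t_le: "t \<le> s" if "s \<in> T" for s unfolding t_def using finT that by simp
  have xb: "0 \<le> x e \<and> x e \<le> 1" for e
    using x by (simp add: capped_polytope_def hypersimplex_def)
  have xij: "0 < x i" "x i < 1" "0 < x j" "x j < 1" "i \<in> E" "j \<in> E"
    using ij xb[of i] xb[of j] by (auto simp: fractional_def order_less_le)
  have xF: "sum x A \<le> f A" if "A \<in> \<F>" for A using x that by (simp add: capped_polytope_def)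
  have pos: "f A - sum x A > 0" if "A \<in> \<A>" for A
    using that xF[of A] unseparated[of A] by (auto simp: \<A>_def order_less_le)
  then have tpos: "t > 0" using tT xij by (auto simp: T_def)
  have sum_y: "sum y A = sum x A + t * (of_bool (i \<in> A) - of_bool (j \<in> A))" if "finite A" for A
  proof -
    have "sum (\<lambda>e. of_bool (e = k) :: real) A = of_bool (k \<in> A)" for k
      using that by (simp add: of_bool_def sum.delta)
    then show ?thesis unfolding y_def
      by (simp add: sum.distrib sum_subtractf flip: sum_distrib_left)
  qed
  have "y \<in> P"
    unfolding capped_polytope_def hypersimplex_def
  proof (intro CollectI conjI ballI allI impI)
    fix e
    show "0 \<le> y e" "y e \<le> 1"
      using xb[of e] tpos ij(3) t_le[of "1 - x i"] t_le[of "x j"] by (auto simp: y_def T_def)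
    assume "e \<notin> E"
    then show "y e = 0"
      using x xij by (auto simp: y_def capped_polytope_def hypersimplex_def)
  next
    show "sum y E = real r"
      using x xij finite_E by (simp add: sum_y capped_polytope_def hypersimplex_def)
  next
    fix A assume A: "A \<in> \<F>"
    show "sum y A \<le> real (f A)"
    proof (cases "A \<in> \<A>")
      case True
      then have "t \<le> f A - sum x A" by (intro t_le) (auto simp: T_def)
      then show ?thesis using True A finite_member by (simp add: sum_y \<A>_def)
    next
      case False
      then have "of_bool (i \<in> A) - of_bool (j \<in> A) \<le> (0::real)" using A by (auto simp: \<A>_def)
      then have "t * (of_bool (i \<in> A) - of_bool (j \<in> A)) \<le> 0"
        using tpos by (simp add: mult_nonneg_nonpos)
      then show ?thesis using xF[OF A] sum_y[OF finite_member[OF A]] by simp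
    qed
  qed
  moreover have "defect y < defect x"
  proof -
    have fr: "fractional y \<subseteq> fractional x"
      using ij by (auto simp: fractional_def y_def)
    have sl: "slack y \<subseteq> slack x"
      using unseparated finite_member by (auto simp: slack_def sum_y)
    have fin: "finite (fractional x)" "finite (slack x)"
      using finite_E finite_family by (auto simp: fractional_def slack_def)
    consider "t = 1 - x i" | "t = x j" | A where "A \<in> \<A>" "t = f A - sum x A"
      using tT unfolding T_def by blast
    then have "fractional y \<subset> fractional x \<or> slack y \<subset> slack x"
    proof cases
      case 1
      then have "y i = 1" using ij by (simp add: y_def)
      then have "i \<notin> fractional y" by (simp add: fractional_def)
      then show ?thesis using ij fr by blast
    next
      case 2
      then have "y j = 0" using ij by (simp add: y_def)
      then have "j \<notin> fractional y" by (simp add: fractional_def)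
      then show ?thesis using ij fr by blast
    next
      case 3
      then have "sum y A = f A" using finite_member by (simp add: sum_y \<A>_def)
      then have "A \<notin> slack y" by (simp add: slack_def)
      moreover have "A \<in> slack x" using pos[OF 3(1)] 3(1) by (auto simp: slack_def \<A>_def)
      ultimately show ?thesis using sl by blast
    qed
    then show ?thesis
      unfolding defect_def
      using psubset_card_mono[OF fin(1)] psubset_card_mono[OF fin(2)]
        card_mono[OF fin(1) fr] card_mono[OF fin(2) sl] by (meson add_less_le_mono add_le_less_mono)
  qed
  ultimately show ?thesis using that[of t] tpos unfolding y_def by blast
qed

text \<open>
  A minimal tight set \<open>T\<close> meeting the fractional support contains two fractional elements, and by
  uncrossing no tight set separates them, so mass can be moved between them in both directions.
\<close>

theorem integral_hull:
  assumes "x \<in> P"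
  shows "x \<in> convex hull {v \<in> P. \<forall>e. v e = 0 \<or> v e = 1}" (is "_ \<in> convex hull ?V")
  using assms
proof (induction "defect x" arbitrary: x rule: less_induct)
  case less
  show ?case
  proof (cases "fractional x = {}")
    case True
    have "x e = 0 \<or> x e = 1" for e
      using True less(2) by (cases "e \<in> E") (auto simp: fractional_def capped_polytope_def hypersimplex_def)
    then show ?thesis using less(2) by (intro hull_inc) simp
  next
    case False
    define \<T> where "\<T> = {T \<in> \<F>. sum x T = f T \<and> T \<inter> fractional x \<noteq> {}}"
    have "E \<in> \<T>"
      using False less(2) E_in_family cap_E
      by (auto simp: \<T>_def fractional_def capped_polytope_def hypersimplex_def)
    then obtain T where T: "T \<in> \<T>" and T_min: "\<And>S. S \<in> \<T> \<Longrightarrow> card T \<le> card S"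
      using ex_has_least_nat[of "\<lambda>T. T \<in> \<T>" E card] by blast
    have TF: "T \<in> \<F>" "sum x T = f T" using T by (auto simp: \<T>_def)
    have finT: "finite T" using TF finite_member by blast
    have T_sub: "T \<subseteq> E" using TF family_subset by blast
    obtain i where i: "i \<in> T" "i \<in> fractional x" using T by (auto simp: \<T>_def)
    \<comment> \<open>A single fractional coordinate in \<open>T\<close> would be the difference of
      the integer cap and a sum of integers, hence an integer strictly between 0 and 1.\<close>
    have "\<exists>j\<in>T. j \<in> fractional x \<and> j \<noteq> i"
    proof (rule ccontr)
      assume neg: "\<not> ?thesis"
      have "x e \<in> \<int>" if "e \<in> T - {i}" for e
        using neg that T_sub by (auto simp: fractional_def)
      then have "sum x (T - {i}) \<in> \<int>" by (rule Ints_sum)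
      moreover have "x i = f T - sum x (T - {i})"
        using TF(2) i finT by (simp add: sum_diff1)
      ultimately have "x i \<in> \<int>" by simp
      then obtain z where z: "x i = real_of_int z" by (auto elim: Ints_cases)
      have "0 \<le> x i" "x i \<le> 1" "x i \<noteq> 0" "x i \<noteq> 1"
        using less(2) i by (auto simp: fractional_def capped_polytope_def hypersimplex_def)
      then show False unfolding z by simp
    qed
    then obtain j where j: "j \<in> T" "j \<in> fractional x" "j \<noteq> i" by blast
    have unsep: "l \<in> A" if "A \<in> \<F>" "sum x A = f A" "k \<in> A" "k \<in> T" "k \<in> fractional x" "l \<in> T" for A k l
    proof (rule ccontr)
      assume "l \<notin> A"
      have "A \<inter> T \<in> \<T>" using tight_Int[OF less(2) that(1) TF(1) that(2) TF(2)] that unfolding \<T>_def by blast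
      then have "card T \<le> card (A \<inter> T)" by (rule T_min)
      then have "A \<inter> T = T" using finT by (intro card_seteq) auto
      then show False using \<open>l \<notin> A\<close> that by blast
    qed
    have sep: "i \<in> A \<longleftrightarrow> j \<in> A" if "A \<in> \<F>" "sum x A = f A" for A
      using unsep[OF that] i j by blast
    obtain t where t: "t > 0" "(\<lambda>e. x e + t * (of_bool (e = i) - of_bool (e = j))) \<in> P"
        "defect (\<lambda>e. x e + t * (of_bool (e = i) - of_bool (e = j))) < defect x"
      by (rule shift[OF less(2) i(2) j(2) j(3)[symmetric] sep])
    obtain s where s: "s > 0" "(\<lambda>e. x e + s * (of_bool (e = j) - of_bool (e = i))) \<in> P"
        "defect (\<lambda>e. x e + s * (of_bool (e = j) - of_bool (e = i))) < defect x"
      by (rule shift[OF less(2) j(2) i(2) j(3) sep[symmetric]])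
    let ?y = "\<lambda>e. x e + t * (of_bool (e = i) - of_bool (e = j))"
    let ?z = "\<lambda>e. x e + s * (of_bool (e = j) - of_bool (e = i))"
    note hulls = less(1)[OF t(3,2)] less(1)[OF s(3,2)]
    have st: "s / (s + t) + t / (s + t) = 1" using s(1) t(1) by (simp flip: add_divide_distrib)
    \<comment> \<open>The displacements by \<open>t\<close> and by \<open>s\<close> go in opposite
      directions, and these weights cancel them.\<close>
    have "(s / (s + t)) *\<^sub>R ?y + (t / (s + t)) *\<^sub>R ?z \<in> convex hull ?V"
      using s(1) t(1) st hulls by (intro convexD[OF convex_convex_hull]) auto
    also have "(s / (s + t)) *\<^sub>R ?y + (t / (s + t)) *\<^sub>R ?z = x"
    proof
      fix e
      have "s / (s + t) * (x e + t * d) + t / (s + t) * (x e + s * - d) = x e" for d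
      proof -
        have "s / (s + t) * (x e + t * d) + t / (s + t) * (x e + s * - d) = (s / (s + t) + t / (s + t)) * x e"
          by (simp add: algebra_simps)
        then show ?thesis using st by simp
      qed
      from this[of "of_bool (e = i) - of_bool (e = j)"]
      show "((s / (s + t)) *\<^sub>R ?y + (t / (s + t)) *\<^sub>R ?z) e = x e"
        by (simp add: scaleR_fun_def)
    qed
    finally show ?thesis .
  qed
qed

lemma polytope_eq_hull:
  "convex hull (indicat_real ` {B. B \<subseteq> E \<and> card B = r \<and> (\<forall>A\<in>\<F>. card (B \<inter> A) \<le> f A)}) = P"
  (is "convex hull (indicat_real ` ?B) = P")
proof
  have mem: "indicat_real B \<in> P \<longleftrightarrow> B \<in> ?B" for B
    using indicator_in_capped_polytope[OF finite_E family_subset] by auto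
  show "convex hull (indicat_real ` ?B) \<subseteq> P"
    using mem by (intro hull_minimal convex_capped_polytope) auto
  have verts: "{v \<in> P. \<forall>e. v e = 0 \<or> v e = 1} \<subseteq> indicat_real ` ?B"
  proof
    fix v assume v: "v \<in> {v \<in> P. \<forall>e. v e = 0 \<or> v e = 1}"
    then have "v \<in> hypersimplex E r" "\<forall>e. v e = 0 \<or> v e = 1" by (auto simp: capped_polytope_def)
    then obtain B where B: "v = indicat_real B" by (rule integral_point)
    then have "B \<in> ?B" using v mem[of B] by simp
    then show "v \<in> indicat_real ` ?B" unfolding B by (rule imageI)
  qed
  show "P \<subseteq> convex hull (indicat_real ` ?B)"
  proof
    fix x assume "x \<in> P"
    then have "x \<in> convex hull {v \<in> P. \<forall>e. v e = 0 \<or> v e = 1}" by (rule integral_hull)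
    then show "x \<in> convex hull (indicat_real ` ?B)" by (rule subsetD[OF hull_mono[OF verts]])
  qed
qed

end

section \<open>Base polytopes from rank inequalities\<close>

context base_matroid
begin

theorem base_polytope_eq:
  "base_polytope M = capped_polytope (ground M) (matroid_rank M) (Pow (ground M)) (rank_of M)"
proof -
  interpret cap_family "ground M" "matroid_rank M" "Pow (ground M)" "rank_of M"
  proof
    show "finite (ground M)" by (rule finite_ground)
    show "rank_of M (ground M) = matroid_rank M" by (simp add: matroid_rank_def)
    fix x A B
    assume x: "x \<in> capped_polytope (ground M) (matroid_rank M) (Pow (ground M)) (rank_of M)"
      and A: "A \<in> Pow (ground M)" and B: "B \<in> Pow (ground M)"
      and t: "sum x A = rank_of M A" "sum x B = rank_of M B"
    have fin: "finite A" "finite B" using A B finite_ground finite_subset by auto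
    \<comment> \<open>Modularity of \<open>sum x\<close> against submodularity of the rank leaves no
      slack on \<open>A \<inter> B\<close>.\<close>
    have "sum x (A \<union> B) + sum x (A \<inter> B) = sum x A + sum x B" using fin by (rule sum.union_inter)
    moreover have "sum x (A \<union> B) \<le> rank_of M (A \<union> B)" "sum x (A \<inter> B) \<le> rank_of M (A \<inter> B)"
      using x A B by (auto simp: capped_polytope_def)
    moreover have "real (rank_of M (A \<union> B) + rank_of M (A \<inter> B)) \<le> rank_of M A + rank_of M B"
      using rank_submodular A B by (simp only: of_nat_le_iff Pow_iff)
    ultimately show "A \<inter> B \<in> Pow (ground M) \<and> sum x (A \<inter> B) = rank_of M (A \<inter> B)"
      using t A by auto
  qed auto
  have "bases M = {B. B \<subseteq> ground M \<and> card B = matroid_rank M \<and>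
      (\<forall>A\<in>Pow (ground M). card (B \<inter> A) \<le> rank_of M A)}" (is "_ = ?B")
  proof (intro equalityI subsetI)
    fix B assume "B \<in> bases M"
    then show "B \<in> ?B" by (simp add: basis_subset card_basis card_basis_Int_le)
  next
    fix B assume B: "B \<in> ?B"
    \<comment> \<open>The inequality for the set \<open>B\<close> itself already forces
      independence.\<close>
    then have "card (B \<inter> B) \<le> rank_of M B" by blast
    moreover have "finite B" using B finite_ground finite_subset by blast
    ultimately show "B \<in> bases M" using B basis_iff_indep[of B] indep_iff_rank[of B] by simp
  qed
  then show ?thesis unfolding base_polytope_def using polytope_eq_hull by simp
qed

end

section \<open>Matroids capped along a chain\<close>

text \<open>One construction covers all Schubert matroids that have to be exhibited: the uniform
  matroid, the uniform matroid with a basis removed, and every term of the chain expansion.\<close>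

definition capped :: "'a set \<Rightarrow> nat \<Rightarrow> 'a set set \<Rightarrow> ('a set \<Rightarrow> nat) \<Rightarrow> 'a matroid" where
  "capped E r d k = Matroid E {B. B \<subseteq> E \<and> card B = r \<and> (\<forall>A\<in>d. card (B \<inter> A) \<le> k A)}"

lemma Union_chain_in:
  assumes "finite \<A>" "\<A> \<noteq> {}" "\<And>A B. A \<in> \<A> \<Longrightarrow> B \<in> \<A> \<Longrightarrow> A \<subseteq> B \<or> B \<subseteq> A"
  shows "\<Union>\<A> \<in> \<A>"
  using assms
proof (induction \<A> rule: finite_ne_induct)
  case (insert A \<A>)
  then have "\<Union>\<A> \<in> \<A>" by blast
  then have "A \<subseteq> \<Union>\<A> \<or> \<Union>\<A> \<subseteq> A" using insert.prems by blast
  then show ?case using \<open>\<Union>\<A> \<in> \<A>\<close> by (auto simp: Un_absorb1 Un_absorb2)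
qed simp

locale capped_chain =
  fixes E :: "'a set" and r :: nat and d :: "'a set set" and k :: "'a set \<Rightarrow> nat"
  assumes finite_E: "finite E"
    and proper: "\<And>A. A \<in> d \<Longrightarrow> A \<subset> E"
    and chain: "\<And>A B. A \<in> d \<Longrightarrow> B \<in> d \<Longrightarrow> A \<subseteq> B \<or> B \<subseteq> A"
    and nonempty: "bases (capped E r d k) \<noteq> {}"
begin

text \<open>The size bound \<open>r\<close> becomes a cap on \<open>E\<close>, so feasibility is a
  single condition over a chain with largest member \<open>E\<close>.\<close>

definition "d' = insert E d"
definition "k' A = (if A = E then r else k A)"

definition feasible :: "'a set \<Rightarrow> bool" where
  "feasible I \<longleftrightarrow> I \<subseteq> E \<and> (\<forall>A\<in>d'. card (I \<inter> A) \<le> k' A)"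

lemma d'_subset: "A \<in> d' \<Longrightarrow> A \<subseteq> E"
  using proper by (auto simp: d'_def)

lemma d'_chain: "A \<in> d' \<Longrightarrow> B \<in> d' \<Longrightarrow> A \<subseteq> B \<or> B \<subseteq> A"
  using proper chain by (auto simp: d'_def)

lemma finite_d': "finite d'"
  by (rule finite_subset[of _ "Pow E"]) (use d'_subset finite_E in auto)

lemma caps_iff: "(\<forall>A\<in>d'. g A \<le> k' A) \<longleftrightarrow> g E \<le> r \<and> (\<forall>A\<in>d. g A \<le> k A)"
  using proper by (auto simp: d'_def k'_def)

lemma caps_iff_real:
  "(\<forall>A\<in>d'. g A \<le> real (k' A)) \<longleftrightarrow> g E \<le> real r \<and> (\<forall>A\<in>d. g A \<le> real (k A))"
  using proper by (auto simp: d'_def k'_def)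

lemma bases_capped: "B \<in> bases (capped E r d k) \<longleftrightarrow> feasible B \<and> card B = r"
proof -
  have "B \<subseteq> E \<Longrightarrow> B \<inter> E = B" by blast
  then show ?thesis unfolding feasible_def caps_iff by (auto simp: capped_def)
qed

lemma feasible_subset: "feasible I \<Longrightarrow> J \<subseteq> I \<Longrightarrow> feasible J"
  unfolding feasible_def using finite_E
  by (meson Int_mono card_mono finite_Int finite_subset order_refl order_trans)

text \<open>Let \<open>Z\<close> be the largest member whose cap is attained by \<open>I\<close>
  (empty if there is none). Inside \<open>Z\<close> the set \<open>B\<close> has no more elements
  than \<open>I\<close>, so outside it has more, and an element outside \<open>Z\<close> lies in no
  full member.\<close>

lemma feasible_grow:
  assumes I: "feasible I" "card I < r" and B: "feasible B" "card B = r"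
  obtains y where "y \<in> B - I" "feasible (insert y I)"
proof -
  define Z where "Z = \<Union>{A \<in> d'. card (I \<inter> A) = k' A}"
  have fin: "finite I" "finite B"
    using I B finite_E finite_subset unfolding feasible_def by auto
  have "card (B \<inter> Z) \<le> card (I \<inter> Z)"
  proof (cases "{A \<in> d'. card (I \<inter> A) = k' A} = {}")
    case True
    have "Z = {}" unfolding Z_def True by simp
    then show ?thesis by simp
  next
    case False
    then have "Z \<in> {A \<in> d'. card (I \<inter> A) = k' A}"
      unfolding Z_def using finite_d' d'_chain by (intro Union_chain_in) auto
    then show ?thesis using B(1) by (auto simp: feasible_def)
  qed
  moreover have "card (I - Z) = card I - card (I \<inter> Z)" "card (B - Z) = card B - card (B \<inter> Z)"
    using fin by (auto simp: card_Diff_subset_Int)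
  moreover have "card (B \<inter> Z) \<le> card B" "card (I \<inter> Z) \<le> card I"
    using fin by (auto intro: card_mono)
  ultimately have "card (I - Z) < card (B - Z)" using I B by linarith
  then have "\<not> B - Z \<subseteq> I - Z" using fin card_mono[of "I - Z" "B - Z"] by auto
  then obtain y where y: "y \<in> B" "y \<notin> Z" "y \<notin> I" by blast
  have "card (insert y I \<inter> A) \<le> k' A" if A: "A \<in> d'" for A
  proof (cases "y \<in> A")
    case True
    then have "card (I \<inter> A) \<noteq> k' A" using y(2) A unfolding Z_def by blast
    then have "card (I \<inter> A) < k' A" using I(1) A by (auto simp: feasible_def order_less_le)
    moreover have "card (insert y I \<inter> A) \<le> Suc (card (I \<inter> A))"
      using fin True by (simp add: card_insert_if)
    ultimately show ?thesis by linarith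
  next
    case False
    then show ?thesis using I(1) A by (simp add: feasible_def)
  qed
  moreover have "insert y I \<subseteq> E" using I(1) B(1) y(1) unfolding feasible_def by blast
  ultimately have "feasible (insert y I)" unfolding feasible_def by blast
  then show ?thesis using that y by blast
qed

lemma capped_is_matroid: "is_matroid (capped E r d k)"
  unfolding is_matroid_def
proof (intro conjI ballI)
  show "finite (ground (capped E r d k))" using finite_E by (simp add: capped_def)
  show "bases (capped E r d k) \<subseteq> Pow (ground (capped E r d k))" by (auto simp: capped_def)
  show "bases (capped E r d k) \<noteq> {}" by (rule nonempty)
  fix A B x assume "A \<in> bases (capped E r d k)" "B \<in> bases (capped E r d k)" and x: "x \<in> A - B"
  then have A: "feasible A" "card A = r" and B: "feasible B" "card B = r"
    by (auto simp: bases_capped)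
  have fin: "finite A" using A finite_E finite_subset unfolding feasible_def by auto
  have I: "feasible (A - {x})" using A(1) by (rule feasible_subset) blast
  have c: "card (A - {x}) < r" using A x fin by (metis Diff_iff card_Diff1_less)
  obtain y where y: "y \<in> B - (A - {x})" "feasible (insert y (A - {x}))"
    using feasible_grow[OF I c B] by blast
  have yA: "y \<in> B - A" using x y by blast
  then have "card (insert y (A - {x})) = r" using card_exchange[OF fin, of x y] x A(2) by simp
  then show "\<exists>y\<in>B - A. insert y (A - {x}) \<in> bases (capped E r d k)"
    using y yA bases_capped by blast
qed

sublocale cm: base_matroid "capped E r d k"
  by unfold_locales (rule capped_is_matroid)

lemma indep_capped: "indep (capped E r d k) I \<longleftrightarrow> feasible I"
proof
  assume "indep (capped E r d k) I"
  then obtain B where "B \<in> bases (capped E r d k)" "I \<subseteq> B" unfolding indep_def by blast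
  then show "feasible I" using feasible_subset[of B I] by (simp add: bases_capped)
next
  obtain B where B: "feasible B" "card B = r" using nonempty bases_capped by blast
  assume "feasible I"
  then show "indep (capped E r d k) I"
  proof (induction "r - card I" arbitrary: I)
    case 0
    have "I \<inter> E = I" using 0(2) unfolding feasible_def by blast
    then have "card I \<le> r" using 0(2) unfolding feasible_def caps_iff by simp
    then show ?case using 0 bases_capped by (intro cm.indep_basis) auto
  next
    case (Suc m)
    then obtain y where y: "y \<in> B - I" "feasible (insert y I)"
      using feasible_grow[OF Suc(3) _ B] by (metis zero_less_Suc zero_less_diff)
    have "finite I" using Suc(3) finite_E finite_subset unfolding feasible_def by blast
    then have "m = r - card (insert y I)" using y Suc(2) by simp
    then have "indep (capped E r d k) (insert y I)" using Suc(1) y by blast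
    then show ?case by (rule cm.indep_subset) blast
  qed
qed

lemma ground_capped: "ground (capped E r d k) = E"
  by (simp add: capped_def)

lemma rank_capped: "matroid_rank (capped E r d k) = r"
proof -
  obtain B where "B \<in> bases (capped E r d k)" using nonempty by blast
  then show ?thesis using cm.card_basis[of B] by (simp add: bases_capped)
qed

lemma rank_le_cap: "A \<in> d' \<Longrightarrow> rank_of (capped E r d k) A \<le> k' A"
proof (rule cm.rank_le)
  fix I assume "A \<in> d'" "I \<subseteq> A" "indep (capped E r d k) I"
  then show "card I \<le> k' A"
    unfolding indep_capped feasible_def by (metis Int_absorb2)
qed

text \<open>Minimality puts a circuit inside some member that it overfills. The largest such member
  \<open>A\<close> contains \<open>F\<close>; a circuit overfilling it, minus a point, gives at
  least \<open>k' A\<close> independent elements in \<open>F\<close>, so a flat cannot stop short of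
  \<open>A\<close>.\<close>

lemma cyclic_flat_capped:
  assumes "F \<in> cyclic_flats (capped E r d k)"
  shows "F = {} \<or> F \<in> d'"
proof -
  obtain \<C> where \<C>: "\<And>C. C \<in> \<C> \<Longrightarrow> circuit (capped E r d k) C" "F = \<Union>\<C>"
    and flat: "flat (capped E r d k) F"
    using assms unfolding cyclic_flats_def by blast
  define \<A> where "\<A> = {A \<in> d'. \<exists>C\<in>\<C>. C \<subseteq> A \<and> k' A < card C}"
  have cover: "\<exists>A\<in>\<A>. C \<subseteq> A" if "C \<in> \<C>" for C
  proof -
    have C: "C \<subseteq> E" "\<not> feasible C" "\<And>D. D \<subset> C \<Longrightarrow> feasible D"
      using \<C>(1)[OF that] unfolding circuit_def indep_capped ground_capped by auto
    then obtain A where A: "A \<in> d'" "k' A < card (C \<inter> A)"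
      unfolding feasible_def by force
    have "\<not> feasible (C \<inter> A)"
    proof
      assume "feasible (C \<inter> A)"
      then have "card (C \<inter> A \<inter> A) \<le> k' A" using A(1) unfolding feasible_def by blast
      then show False using A(2) by simp
    qed
    then have "C \<inter> A = C" using C(3)[of "C \<inter> A"] by blast
    then show ?thesis using A that unfolding \<A>_def by auto
  qed
  show ?thesis
  proof (cases "\<A> = {}")
    case True
    then have "\<C> = {}" using cover by blast
    then show ?thesis using \<C>(2) by simp
  next
    case False
    have "\<Union>\<A> \<in> \<A>"
      using False finite_d' d'_chain by (intro Union_chain_in) (auto simp: \<A>_def)
    then obtain A C where A: "A = \<Union>\<A>" "A \<in> d'" and C: "C \<in> \<C>" "C \<subseteq> A" "k' A < card C"
      unfolding \<A>_def by blast
    have FA: "F \<subseteq> A" unfolding \<C>(2) A(1) using cover by blast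
    have CF: "C \<subseteq> F" unfolding \<C>(2) using C(1) by blast
    obtain c where c: "c \<in> C" using C(3) by fastforce
    have "indep (capped E r d k) (C - {c})"
      using \<C>(1)[OF C(1)] c unfolding circuit_def by blast
    then have "card (C - {c}) \<le> rank_of (capped E r d k) F"
      using CF by (intro cm.card_le_rank) auto
    then have rF: "k' A \<le> rank_of (capped E r d k) F"
      using c C(3) by (simp add: card_Diff_singleton)
    have "A \<subseteq> F"
    proof
      fix x assume x: "x \<in> A"
      show "x \<in> F"
      proof (rule ccontr)
        assume "x \<notin> F"
        then have "rank_of (capped E r d k) F < rank_of (capped E r d k) (insert x F)"
          using flat x d'_subset[OF A(2)] unfolding flat_def ground_capped by blast
        also have "\<dots> \<le> rank_of (capped E r d k) A"
          using x FA by (intro cm.rank_mono) auto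
        also have "\<dots> \<le> k' A" using A(2) by (rule rank_le_cap)
        finally show False using rF by simp
      qed
    qed
    then show ?thesis using FA A(2) by simp
  qed
qed

lemma schubert_capped: "schubert (capped E r d k)"
proof -
  have "F \<subseteq> G \<or> G \<subseteq> F"
    if "F \<in> cyclic_flats (capped E r d k)" "G \<in> cyclic_flats (capped E r d k)" for F G
    using cyclic_flat_capped[OF that(1)] cyclic_flat_capped[OF that(2)] d'_chain[of F G] by blast
  then show ?thesis unfolding schubert_def using capped_is_matroid by blast
qed

lemma base_polytope_capped: "base_polytope (capped E r d k) = capped_polytope E r d k"
proof -
  interpret cap_family E r d' k'
  proof
    fix x A B assume "A \<in> d'" "B \<in> d'" "sum x A = real (k' A)" "sum x B = real (k' B)"
    moreover have "A \<inter> B = A \<or> A \<inter> B = B" using d'_chain[of A B] calculation by blast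
    ultimately show "A \<inter> B \<in> d' \<and> sum x (A \<inter> B) = real (k' (A \<inter> B))" by auto
  qed (use finite_E d'_subset in \<open>auto simp: d'_def k'_def\<close>)
  have "bases (capped E r d k) = {B. B \<subseteq> E \<and> card B = r \<and> (\<forall>A\<in>d'. card (B \<inter> A) \<le> k' A)}"
    using bases_capped unfolding feasible_def by blast
  then have "base_polytope (capped E r d k) = capped_polytope E r d' k'"
    unfolding base_polytope_def using polytope_eq_hull by simp
  \<comment> \<open>The extra cap on \<open>E\<close> holds with equality throughout the
    hypersimplex.\<close>
  also have "\<dots> = capped_polytope E r d k"
    unfolding capped_polytope_def caps_iff_real by (auto simp: hypersimplex_def)
  finally show ?thesis .
qed

end

section \<open>Existence of Schubert expansions\<close>

lemma sum_sign_reversing: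
  fixes f :: "'a \<Rightarrow> int"
  assumes "\<And>x. x \<in> S \<Longrightarrow> \<phi> x \<in> S" "\<And>x. x \<in> S \<Longrightarrow> \<phi> (\<phi> x) = x" "\<And>x. x \<in> S \<Longrightarrow> f (\<phi> x) = - f x"
  shows "sum f S = 0"
proof -
  have "sum f S = sum (\<lambda>x. f (\<phi> x)) S"
    by (rule sum.reindex_bij_witness[of S \<phi> \<phi>]) (use assms in auto)
  also have "\<dots> = - sum f S" using assms(3) by (simp add: sum_negf)
  finally show ?thesis by simp
qed

lemma Inter_chain_in:
  assumes "finite \<A>" "\<A> \<noteq> {}" "\<And>A B. A \<in> \<A> \<Longrightarrow> B \<in> \<A> \<Longrightarrow> A \<subseteq> B \<or> B \<subseteq> A"
  shows "\<Inter>\<A> \<in> \<A>"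
  using assms
proof (induction \<A> rule: finite_ne_induct)
  case (insert A \<A>)
  then have "\<Inter>\<A> \<in> \<A>" by blast
  then have "A \<subseteq> \<Inter>\<A> \<or> \<Inter>\<A> \<subseteq> A" using insert.prems by blast
  then show ?case using \<open>\<Inter>\<A> \<in> \<A>\<close> by (auto simp: Int_absorb1 Int_absorb2)
qed simp

text \<open>The empty chain is included, so for a finite family the sum of
  \<open>(-1) ^ card c\<close> is minus the reduced Euler characteristic of the order complex: 1 for
  the empty family, 0 for a contractible complex.\<close>

definition chains_in :: "'a set set \<Rightarrow> 'a set set set" where
  "chains_in \<B> = {c. c \<subseteq> \<B> \<and> (\<forall>A\<in>c. \<forall>B\<in>c. A \<subseteq> B \<or> B \<subseteq> A)}"

text \<open>
  The map \<open>A \<ge> A \<inter> T \<le> T\<close> contracts the order complex of the family conically. The matching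
  below toggles the trace on \<open>T\<close> of the smallest member of the chain not contained in \<open>T\<close>, or
  \<open>T\<close> itself if there is no such member; \<open>\<Inter>{} = UNIV\<close> covers the second case.
\<close>

lemma sum_chains_conical:
  assumes fin: "finite \<B>" and T: "T \<in> \<B>" and closed: "\<And>A. A \<in> \<B> \<Longrightarrow> A \<inter> T \<in> \<B>"
  shows "(\<Sum>c\<in>chains_in \<B>. (-1) ^ card c) = (0::int)"
proof (rule sum_sign_reversing)
  define U where "U c = {A \<in> c. \<not> A \<subseteq> T}" for c
  define p where "p c = \<Inter>(U c) \<inter> T" for c
  define \<phi> where "\<phi> c = (if p c \<in> c then c - {p c} else insert (p c) c)" for c
  have U: "U (\<phi> c) = U c" for c
    unfolding U_def \<phi>_def p_def by auto
  then have p: "p (\<phi> c) = p c" for c unfolding p_def by simp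
  fix c assume c: "c \<in> chains_in \<B>"
  have fin_c: "finite c" using c fin finite_subset unfolding chains_in_def by blast
  show "\<phi> (\<phi> c) = c"
    using p[of c] unfolding \<phi>_def by auto
  have "p c \<in> \<B>"
  proof (cases "U c = {}")
    case True
    then show ?thesis using T by (simp add: p_def)
  next
    case False
    have "finite (U c)" using fin_c by (simp add: U_def)
    then have "\<Inter>(U c) \<in> U c"
      using False
      by (rule Inter_chain_in) (use c in \<open>auto simp: chains_in_def U_def\<close>)
    then show ?thesis using c closed unfolding p_def U_def chains_in_def by blast
  qed
  moreover have "A \<subseteq> p c \<or> p c \<subseteq> A" if A: "A \<in> c" for A
  proof (cases "A \<subseteq> T")
    case True
    have "A \<subseteq> A'" if "A' \<in> U c" for A'
      using c A True that unfolding chains_in_def U_def by blast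
    then show ?thesis using True unfolding p_def by blast
  next
    case False
    then show ?thesis using A unfolding p_def U_def by blast
  qed
  ultimately show "\<phi> c \<in> chains_in \<B>"
    using c unfolding chains_in_def \<phi>_def by auto
  show "(-1) ^ card (\<phi> c) = - ((-1) ^ card c :: int)"
  proof (cases "p c \<in> c")
    case True
    then have "card c = Suc (card (c - {p c}))" using fin_c by (simp only: card_Suc_Diff1)
    then show ?thesis unfolding \<phi>_def if_P[OF True] by (simp only: power_Suc)
  next
    case False
    then show ?thesis using fin_c by (simp add: \<phi>_def)
  qed
qed

text \<open>Inclusion-exclusion in product form; it turns the indicator that all members of
  \<open>c\<close> are violated into indicators of capped polytopes.\<close>

lemma prod_one_minus:
  fixes g :: "'a \<Rightarrow> real"
  assumes "finite c"
  shows "(\<Prod>A\<in>c. 1 - g A) = (\<Sum>d\<in>Pow c. (-1) ^ card d * (\<Prod>A\<in>d. g A))"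
proof -
  have "(\<Prod>A\<in>c. 1 - g A) = (\<Prod>A\<in>c. - g A + 1)" by simp
  also have "\<dots> = (\<Sum>d\<in>Pow c. (\<Prod>A\<in>d. - g A) * (\<Prod>A\<in>c - d. 1))"
    using assms by (rule prod_add)
  also have "\<dots> = (\<Sum>d\<in>Pow c. (-1) ^ card d * (\<Prod>A\<in>d. g A))"
    by (simp add: prod_uminus)
  finally show ?thesis .
qed

lemma prod_of_bool: "finite c \<Longrightarrow> (\<Prod>A\<in>c. of_bool (Q A)) = (of_bool (\<forall>A\<in>c. Q A) :: real)"
  by (induction c rule: finite_induct) auto

context base_matroid
begin

text \<open>Every basis of \<open>M\<close> obeys all caps given by the rank, so none of these
  capped families is empty.\<close>

lemma capped_chain_of_rank:
  assumes c: "c \<in> chains_in {A. A \<subset> ground M}" and d: "d \<subseteq> c"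
  shows "capped_chain (ground M) (matroid_rank M) d (rank_of M)"
proof
  obtain B where "B \<in> bases M" using bases_nonempty by blast
  then have "B \<in> bases (capped (ground M) (matroid_rank M) d (rank_of M))"
    by (simp add: capped_def basis_subset card_basis card_basis_Int_le)
  then show "bases (capped (ground M) (matroid_rank M) d (rank_of M)) \<noteq> {}" by blast
next
  have c': "c \<subseteq> {A. A \<subset> ground M}" "\<forall>A\<in>c. \<forall>B\<in>c. A \<subseteq> B \<or> B \<subseteq> A"
    using c unfolding chains_in_def by simp_all
  show "A \<subset> ground M" if "A \<in> d" for A
    using c'(1) d that by auto
  show "A \<subseteq> B \<or> B \<subseteq> A" if "A \<in> d" "B \<in> d" for A B
    using c'(2) subsetD[OF d that(1)] subsetD[OF d that(2)] by simp
qed (rule finite_ground)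

text \<open>At a point of the hypersimplex the inner sum over \<open>d\<close> is, by
  inclusion-exclusion, the indicator that all members of \<open>c\<close> violate their rank
  inequality. What remains is the signed count of chains in the family \<open>\<B>\<close> of
  violated sets. Only proper subsets occur, as the ground set is always tight.\<close>

lemma chain_expansion:
  fixes x :: "'a \<Rightarrow> real"
  defines "\<C> \<equiv> chains_in {A. A \<subset> ground M}"
  shows "indicat_real (base_polytope M) x = (\<Sum>c\<in>\<C>. \<Sum>d\<in>Pow c. (-1) ^ (card c + card d) *
    indicat_real (base_polytope (capped (ground M) (matroid_rank M) d (rank_of M))) x)"
proof -
  let ?E = "ground M" and ?r = "matroid_rank M" and ?rk = "rank_of M"
  have fin\<C>: "finite \<C>"
    unfolding \<C>_def chains_in_def
    by (rule finite_subset[of _ "Pow (Pow ?E)"]) (use finite_ground in auto)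
  have fin_c: "finite c" if "c \<in> \<C>" for c
    using that finite_ground unfolding \<C>_def chains_in_def
    by (auto intro: finite_subset[of _ "Pow ?E"])
  have capped_poly: "base_polytope (capped ?E ?r d ?rk) = capped_polytope ?E ?r d ?rk"
    if "c \<in> \<C>" "d \<subseteq> c" for c d
  proof -
    have "capped_chain ?E ?r d ?rk"
      using capped_chain_of_rank that unfolding \<C>_def by blast
    then show ?thesis by (rule capped_chain.base_polytope_capped)
  qed
  have M_poly: "base_polytope M = capped_polytope ?E ?r (Pow ?E) ?rk" by (rule base_polytope_eq)
  show ?thesis
  proof (cases "x \<in> hypersimplex ?E ?r")
    case False
    then have "indicat_real (base_polytope (capped ?E ?r d ?rk)) x = 0" if "c \<in> \<C>" "d \<subseteq> c" for c d
      using capped_poly[OF that] by (simp add: capped_polytope_def)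
    moreover have "indicat_real (base_polytope M) x = 0"
      using False M_poly by (simp add: capped_polytope_def)
    ultimately show ?thesis by simp
  next
    case True
    define \<B> where "\<B> = {A. A \<subset> ?E \<and> ?rk A < sum x A}"
    have fin\<B>: "finite \<B>"
      unfolding \<B>_def by (rule finite_subset[of _ "Pow ?E"]) (use finite_ground in auto)
    have xE: "sum x ?E = ?rk ?E" using True by (simp add: hypersimplex_def matroid_rank_def)
    have inP: "x \<in> base_polytope M \<longleftrightarrow> \<B> = {}"
    proof -
      have "x \<in> base_polytope M \<longleftrightarrow> (\<forall>A. A \<subseteq> ?E \<longrightarrow> sum x A \<le> ?rk A)"
        using True by (auto simp: M_poly capped_polytope_def)
      also have "\<dots> \<longleftrightarrow> (\<forall>A. A \<subset> ?E \<longrightarrow> sum x A \<le> ?rk A)"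
      proof (intro iffI allI impI)
        fix A assume *: "\<forall>A. A \<subset> ?E \<longrightarrow> sum x A \<le> ?rk A" and "A \<subseteq> ?E"
        then show "sum x A \<le> ?rk A" using xE by (cases "A = ?E") auto
      qed auto
      finally show ?thesis unfolding \<B>_def by (auto simp: not_less)
    qed
    have "(\<Sum>c\<in>\<C>. \<Sum>d\<in>Pow c. (-1) ^ (card c + card d) *
        indicat_real (base_polytope (capped ?E ?r d ?rk)) x)
      = (\<Sum>c\<in>\<C>. (-1) ^ card c * of_bool (c \<subseteq> \<B>))"
    proof (rule sum.cong[OF refl])
      fix c assume c: "c \<in> \<C>"
      have "(\<Sum>d\<in>Pow c. (-1) ^ (card c + card d) * indicat_real (base_polytope (capped ?E ?r d ?rk)) x)
        = (-1) ^ card c * (\<Sum>d\<in>Pow c. (-1) ^ card d * (\<Prod>A\<in>d. of_bool (sum x A \<le> ?rk A)))"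
        unfolding sum_distrib_left
      proof (rule sum.cong[OF refl])
        fix d assume "d \<in> Pow c"
        then have d: "d \<subseteq> c" "finite d" using fin_c[OF c] finite_subset by auto
        then have "indicat_real (base_polytope (capped ?E ?r d ?rk)) x
            = (\<Prod>A\<in>d. of_bool (sum x A \<le> ?rk A))"
          using capped_poly[OF c d(1)] True
          by (simp add: prod_of_bool capped_polytope_def indicator_def)
        then show "(-1) ^ (card c + card d) * indicat_real (base_polytope (capped ?E ?r d ?rk)) x =
            (-1) ^ card c * ((-1) ^ card d * (\<Prod>A\<in>d. of_bool (sum x A \<le> ?rk A)))"
          by (simp add: power_add)
      qed
      also have "\<dots> = (-1) ^ card c * (\<Prod>A\<in>c. 1 - of_bool (sum x A \<le> ?rk A))"
        by (subst prod_one_minus[OF fin_c[OF c]]) (rule refl)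
      also have "(\<Prod>A\<in>c. 1 - of_bool (sum x A \<le> ?rk A)) = (\<Prod>A\<in>c. of_bool (?rk A < sum x A) :: real)"
        by (rule prod.cong) auto
      also have "\<dots> = of_bool (\<forall>A\<in>c. ?rk A < sum x A)" by (rule prod_of_bool[OF fin_c[OF c]])
      also have "(\<forall>A\<in>c. ?rk A < sum x A) \<longleftrightarrow> c \<subseteq> \<B>"
        using c unfolding \<B>_def \<C>_def chains_in_def by blast
      finally show "(\<Sum>d\<in>Pow c. (-1) ^ (card c + card d) *
          indicat_real (base_polytope (capped ?E ?r d ?rk)) x) = (-1) ^ card c * of_bool (c \<subseteq> \<B>)" .
    qed
    also have "\<dots> = (\<Sum>c\<in>chains_in \<B>. (-1) ^ card c)"
    proof -
      have "chains_in \<B> = {c \<in> \<C>. c \<subseteq> \<B>}" unfolding chains_in_def \<C>_def \<B>_def by blast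
      then show ?thesis by (simp add: of_bool_def if_distrib sum.inter_filter[OF fin\<C>] cong: if_cong)
    qed
    also have "\<dots> = real_of_int (\<Sum>c\<in>chains_in \<B>. (-1) ^ card c)" by simp
    also have "(\<Sum>c\<in>chains_in \<B>. (-1) ^ card c) = (of_bool (\<B> = {}) :: int)"
    proof (cases "\<B> = {}")
      case True
      then have "chains_in \<B> = {{}}" by (auto simp: chains_in_def)
      then show ?thesis using True by simp
    next
      case False
      \<comment> \<open>\<open>D\<close> is submodular; let \<open>T\<close> minimise it. Then
        \<open>D T \<le> D (A \<union> T)\<close> gives
        \<open>D (A \<inter> T) \<le> D A < 0\<close>, so the violated family is closed under
        intersection with \<open>T\<close>. The minimum is negative while \<open>D\<close> vanishes
        on the ground set, so \<open>T\<close> is proper.\<close>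
      define D where "D A = ?rk A - sum x A" for A
      have "\<exists>T. T \<in> Pow ?E \<and> (\<forall>A\<in>Pow ?E. D T \<le> D A)"
        using arg_min_if_finite[of "Pow ?E" D] finite_ground
        by (intro exI[of _ "arg_min_on D (Pow ?E)"]) (auto simp: not_less)
      then obtain T where T: "T \<subseteq> ?E" "\<And>A. A \<subseteq> ?E \<Longrightarrow> D T \<le> D A" by blast
      obtain A where A: "A \<in> \<B>" using False by blast
      then have "D T < 0" using T(2)[of A] by (auto simp: \<B>_def D_def)
      then have T\<B>: "T \<in> \<B>" using T(1) xE by (auto simp: \<B>_def D_def psubset_eq)
      have "A \<inter> T \<in> \<B>" if "A \<in> \<B>" for A
      proof -
        have A: "A \<subset> ?E" "D A < 0" using that by (auto simp: \<B>_def D_def)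
        have fin: "finite A" "finite T" using A T finite_ground finite_subset by auto
        have "sum x (A \<union> T) + sum x (A \<inter> T) = sum x A + sum x T" using fin by (rule sum.union_inter)
        moreover have "real (?rk (A \<union> T) + ?rk (A \<inter> T)) \<le> ?rk A + ?rk T"
          unfolding of_nat_le_iff using A T by (intro rank_submodular) auto
        moreover have "D T \<le> D (A \<union> T)" using A T by (intro T(2)) auto
        ultimately have "D (A \<inter> T) < 0" using A(2) unfolding D_def by simp
        then show ?thesis using A by (auto simp: \<B>_def D_def)
      qed
      then show ?thesis using sum_chains_conical[OF fin\<B> T\<B>] False by simp
    qed
    finally show ?thesis using inP by (simp add: indicator_def)
  qed
qed

end

lemma finite_matroids: "finite (matroids r n)"
proof (rule finite_subset)
  show "matroids r n \<subseteq> (\<lambda>\<B>. Matroid {1..n} \<B>) ` Pow (Pow {1..n})"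
  proof
    fix M assume M: "M \<in> matroids r n"
    then have "M = Matroid {1..n} (bases M)" by (cases M) (simp add: matroids_def)
    moreover have "bases M \<in> Pow (Pow {1..n})" using M base_matroid.basis_subset[of M]
      unfolding matroids_def base_matroid_def by blast
    ultimately show "M \<in> (\<lambda>\<B>. Matroid {1..n} \<B>) ` Pow (Pow {1..n})" by (rule image_eqI)
  qed
qed simp

lemma finite_schuberts: "finite (schuberts r n)"
  unfolding schuberts_def by (rule finite_subset[OF _ finite_matroids]) auto

lemma schubert_expansion_exists:
  assumes "M \<in> matroids r n"
  shows "\<exists>a::nat matroid \<Rightarrow> int. (\<forall>S. S \<notin> schuberts r n \<longrightarrow> a S = 0) \<and>
    (\<forall>x. indicat_real (base_polytope M) x =
      (\<Sum>S\<in>schuberts r n. of_int (a S) * indicat_real (base_polytope S) x))"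
proof -
  interpret base_matroid M using assms by unfold_locales (simp add: matroids_def)
  have M: "ground M = {1..n}" "matroid_rank M = r" using assms by (auto simp: matroids_def)
  define \<C> where "\<C> = chains_in {A. A \<subset> ground M}"
  define S where "S d = capped {1..n} r d (rank_of M)" for d
  \<comment> \<open>Different chains may give the same capped matroid, so their signs are collected
    by equality with \<open>T\<close>.\<close>
  define a :: "nat matroid \<Rightarrow> int" where
    "a T = (\<Sum>c\<in>\<C>. \<Sum>d\<in>Pow c. (-1) ^ (card c + card d) * of_bool (S d = T))" for T
  have S_mem: "S d \<in> schuberts r n" if "c \<in> \<C>" "d \<subseteq> c" for c d
  proof -
    have "capped_chain (ground M) (matroid_rank M) d (rank_of M)"
      using that unfolding \<C>_def by (rule capped_chain_of_rank)
    then interpret cc: capped_chain "{1..n}" r d "rank_of M" unfolding M .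
    show ?thesis
      using cc.schubert_capped cc.capped_is_matroid cc.ground_capped cc.rank_capped
      by (simp add: S_def schuberts_def matroids_def)
  qed
  have "a T = 0" if "T \<notin> schuberts r n" for T
  proof -
    have "S d \<noteq> T" if "c \<in> \<C>" "d \<in> Pow c" for c d using S_mem that \<open>T \<notin> _\<close> by blast
    then show ?thesis unfolding a_def by simp
  qed
  moreover have "indicat_real (base_polytope M) x =
      (\<Sum>T\<in>schuberts r n. of_int (a T) * indicat_real (base_polytope T) x)" for x
  proof -
    have "(\<Sum>T\<in>schuberts r n. of_int (a T) * indicat_real (base_polytope T) x)
      = (\<Sum>T\<in>schuberts r n. \<Sum>c\<in>\<C>. \<Sum>d\<in>Pow c.
          (-1) ^ (card c + card d) * of_bool (S d = T) * indicat_real (base_polytope T) x)"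
      unfolding a_def by (simp add: sum_distrib_right)
    also have "\<dots> = (\<Sum>c\<in>\<C>. \<Sum>d\<in>Pow c. \<Sum>T\<in>schuberts r n.
          (-1) ^ (card c + card d) * of_bool (S d = T) * indicat_real (base_polytope T) x)"
      by (subst sum.swap) (intro sum.cong refl sum.swap)
    also have "\<dots> = (\<Sum>c\<in>\<C>. \<Sum>d\<in>Pow c. (-1) ^ (card c + card d) * indicat_real (base_polytope (S d)) x)"
    proof (intro sum.cong refl)
      fix c d assume cd: "c \<in> \<C>" "d \<in> Pow c"
      have "(\<Sum>T\<in>schuberts r n. (-1) ^ (card c + card d) * of_bool (S d = T) * indicat_real (base_polytope T) x)
        = (\<Sum>T\<in>schuberts r n. if S d = T then (-1) ^ (card c + card d) * indicat_real (base_polytope T) x else 0)"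
        by (intro sum.cong) auto
      also have "\<dots> = (-1) ^ (card c + card d) * indicat_real (base_polytope (S d)) x"
        using S_mem[of c d] cd finite_schuberts by (simp add: sum.delta')
      finally show "(\<Sum>T\<in>schuberts r n. (-1) ^ (card c + card d) * of_bool (S d = T) * indicat_real (base_polytope T) x)
        = (-1) ^ (card c + card d) * indicat_real (base_polytope (S d)) x" .
    qed
    also have "\<dots> = indicat_real (base_polytope M) x"
      using chain_expansion[of x] unfolding M S_def \<C>_def by simp
    finally show ?thesis by simp
  qed
  ultimately show ?thesis by blast
qed

section \<open>The Euler characteristic of compact convex sets\<close>

text \<open>For a nonempty compact interval, the sum of
  \<open>[m \<in> I] - [m + \<epsilon> \<in> I]\<close> over finitely many points \<open>m\<close>
  that include its right end is 1 for small \<open>\<epsilon>\<close>: only at the right end does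
  the step leave the interval, and no step enters it. All intervals share one
  \<open>\<epsilon>\<close>, below every gap between endpoints.\<close>

lemma euler_real_line:
  fixes I :: "'i \<Rightarrow> real set" and a :: "'i \<Rightarrow> real"
  assumes fin: "finite J" and I: "\<And>i. i \<in> J \<Longrightarrow> compact (I i) \<and> convex (I i)"
    and zero: "\<And>t. (\<Sum>i\<in>J. a i * indicat_real (I i) t) = 0"
  shows "(\<Sum>i\<in>J. a i * of_bool (I i \<noteq> {})) = 0"
proof -
  have "\<forall>i\<in>J. \<exists>l u. I i = {l..u}"
    using I connected_compact_interval_1 convex_connected by metis
  then obtain l u where lu: "\<And>i. i \<in> J \<Longrightarrow> I i = {l i..u i}" by metis
  define Q where "Q = l ` J \<union> u ` J"
  have finQ: "finite Q" using fin by (simp add: Q_def)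
  have "\<exists>\<epsilon>>0. \<forall>p\<in>Q. \<forall>q\<in>Q. p < q \<longrightarrow> p + \<epsilon> < q"
  proof -
    \<comment> \<open>The element 1 keeps \<open>G\<close> nonempty when there is no gap; halving
      the minimum makes the gap inequality strict.\<close>
    define G where "G = insert 1 ((\<lambda>(p, q). q - p) ` {(p, q) \<in> Q \<times> Q. p < q})"
    have G: "finite G" "G \<noteq> {}" "\<And>g. g \<in> G \<Longrightarrow> g > 0"
      unfolding G_def using finQ by (auto intro: finite_subset[of _ "Q \<times> Q"])
    have "p + Min G / 2 < q" if "p \<in> Q" "q \<in> Q" "p < q" for p q
    proof -
      have "q - p \<in> G" unfolding G_def using that by force
      then have "Min G \<le> q - p" using G(1) by simp
      moreover have "0 < Min G" using G by simp
      ultimately show ?thesis by simp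
    qed
    moreover have "0 < Min G / 2" using G by simp
    ultimately show ?thesis by blast
  qed
  then obtain \<epsilon> where \<epsilon>: "\<epsilon> > 0" "\<And>p q. p \<in> Q \<Longrightarrow> q \<in> Q \<Longrightarrow> p < q \<Longrightarrow> p + \<epsilon> < q" by blast
  have count: "of_bool (I i \<noteq> {}) =
      (\<Sum>m\<in>u ` J. indicat_real (I i) m - indicat_real (I i) (m + \<epsilon>))" if i: "i \<in> J" for i
  proof -
    have Q: "l i \<in> Q" "u i \<in> Q" "\<And>m. m \<in> u ` J \<Longrightarrow> m \<in> Q" using i by (auto simp: Q_def)
    have "indicat_real (I i) m - indicat_real (I i) (m + \<epsilon>) = (if m = u i then of_bool (I i \<noteq> {}) else 0)"
      if "m \<in> u ` J" for m
      using \<epsilon>(1) \<epsilon>(2)[OF Q(3)[OF that] Q(1)] \<epsilon>(2)[OF Q(3)[OF that] Q(2)]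
      unfolding lu[OF i]
      by (cases "m < l i"; cases "m < u i"; cases "m = u i") (auto simp: indicator_def)
    then have "(\<Sum>m\<in>u ` J. indicat_real (I i) m - indicat_real (I i) (m + \<epsilon>)) =
        (\<Sum>m\<in>u ` J. if m = u i then of_bool (I i \<noteq> {}) else 0)"
      by (rule sum.cong[OF refl])
    then show ?thesis using i fin by simp
  qed
  have "(\<Sum>i\<in>J. a i * of_bool (I i \<noteq> {})) =
      (\<Sum>i\<in>J. \<Sum>m\<in>u ` J. a i * (indicat_real (I i) m - indicat_real (I i) (m + \<epsilon>)))"
    by (intro sum.cong refl) (simp add: count sum_distrib_left)
  also have "\<dots> = (\<Sum>m\<in>u ` J. (\<Sum>i\<in>J. a i * indicat_real (I i) m) -
      (\<Sum>i\<in>J. a i * indicat_real (I i) (m + \<epsilon>)))"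
    by (subst sum.swap) (simp add: sum_subtractf right_diff_distrib)
  also have "\<dots> = 0" by (simp add: zero)
  finally show ?thesis .
qed

text \<open>Slicing by one coordinate at a time reduces the statement to the real line.\<close>

lemma euler_characteristic:
  fixes P :: "'i \<Rightarrow> ('e \<Rightarrow> real) set" and a :: "'i \<Rightarrow> real"
  assumes "finite A" "finite J"
    and "\<And>i. i \<in> J \<Longrightarrow> compact (P i) \<and> convex (P i)"
    and "\<And>i x e. i \<in> J \<Longrightarrow> x \<in> P i \<Longrightarrow> e \<notin> A \<Longrightarrow> x e = z e"
    and "\<And>x. (\<Sum>i\<in>J. a i * indicat_real (P i) x) = 0"
  shows "(\<Sum>i\<in>J. a i * of_bool (P i \<noteq> {})) = 0"
  using assms(1,3-)
proof (induction A arbitrary: P z rule: finite_induct)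
  case empty
  have "P i \<noteq> {} \<longleftrightarrow> z \<in> P i" if "i \<in> J" for i
  proof -
    have "x = z" if "x \<in> P i" for x using empty(2)[OF \<open>i \<in> J\<close> that] by auto
    then show ?thesis by blast
  qed
  then have "(\<Sum>i\<in>J. a i * of_bool (P i \<noteq> {})) = (\<Sum>i\<in>J. a i * indicat_real (P i) z)"
    by (intro sum.cong) (auto simp: indicator_def)
  then show ?case using empty(3) by simp
next
  case (insert e A)
  \<comment> \<open>The projections are intervals, and \<open>t \<in> I i\<close> exactly when the
    slice of \<open>P i\<close> at \<open>t\<close> is nonempty; the induction hypothesis for slices
    is therefore the relation that the case of the line needs.\<close>
  define I where "I i = (\<lambda>x. x e) ` P i" for i
  have "(\<Sum>i\<in>J. a i * of_bool (I i \<noteq> {})) = 0"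
  proof (rule euler_real_line[OF assms(2)])
    fix i assume i: "i \<in> J"
    have "compact (I i)"
      unfolding I_def using insert.prems(1)[OF i]
      by (intro compact_continuous_image) (auto intro: continuous_on_subset[OF continuous_on_product_coordinates])
    moreover have "convex (I i)"
    proof (rule convexI)
      fix s t u v :: real
      assume "s \<in> I i" "t \<in> I i" and uv: "0 \<le> u" "0 \<le> v" "u + v = 1"
      then obtain x y where x: "x \<in> P i" "s = x e" and y: "y \<in> P i" "t = y e"
        by (auto simp: I_def)
      have "u *\<^sub>R x + v *\<^sub>R y \<in> P i"
        using insert.prems(1)[OF i] x y uv by (blast intro: convexD)
      then show "u *\<^sub>R s + v *\<^sub>R t \<in> I i"
        unfolding I_def x y by (rule rev_image_eqI) (simp add: scaleR_fun_def)
    qed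
    ultimately show "compact (I i) \<and> convex (I i)" by blast
  next
    fix t
    \<comment> \<open>\<open>z\<close> records the coordinates fixed so far; the slice at
      \<open>t\<close> fixes coordinate \<open>e\<close> as well, leaving only those in
      \<open>A\<close> free.\<close>
    define P' where "P' i = P i \<inter> {x. x e = t}" for i
    have "(\<Sum>i\<in>J. a i * of_bool (P' i \<noteq> {})) = 0"
    proof (rule insert.IH[of _ "z(e := t)"])
      fix i assume i: "i \<in> J"
      have "closed {x :: 'e \<Rightarrow> real. x e = t}"
        by (intro closed_Collect_eq continuous_on_product_coordinates continuous_on_const)
      moreover have "convex {x :: 'e \<Rightarrow> real. x e = t}"
        by (rule convexI) (simp add: scaleR_fun_def flip: distrib_right)
      ultimately show "compact (P' i) \<and> convex (P' i)"
        unfolding P'_def using insert.prems(1)[OF i] by (simp add: compact_Int_closed convex_Int)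
      fix x f assume "x \<in> P' i" "f \<notin> A"
      then show "x f = (z(e := t)) f" using insert.prems(2)[OF i, of x f] by (auto simp: P'_def)
    next
      fix x
      have "indicat_real (P' i) x = indicat_real (P i) x * of_bool (x e = t)" for i
        by (auto simp: P'_def indicator_def)
      then have "(\<Sum>i\<in>J. a i * indicat_real (P' i) x) =
          (\<Sum>i\<in>J. a i * indicat_real (P i) x) * of_bool (x e = t)"
        by (simp add: sum_distrib_right mult.assoc)
      then show "(\<Sum>i\<in>J. a i * indicat_real (P' i) x) = 0" using insert.prems(3) by simp
    qed
    moreover have "of_bool (P' i \<noteq> {}) = indicat_real (I i) t" for i
      by (auto simp: P'_def I_def indicator_def)
    ultimately show "(\<Sum>i\<in>J. a i * indicat_real (I i) t) = 0" by simp
  qed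
  then show ?case by (simp add: I_def)
qed

section \<open>Valuations and uniqueness of Schubert expansions\<close>

lemma compact_capped_polytope: "compact (capped_polytope E r \<F> f)"
proof -
  let ?I = "\<lambda>e. if e \<in> E then {0..1::real} else {0}"
  have "compactin (product_topology (\<lambda>_. euclidean) UNIV) (PiE UNIV ?I)"
    by (auto simp: compactin_PiE)
  then have "compact (PiE UNIV ?I)"
    by (simp add: euclidean_product_topology)
  moreover have "closed {x :: 'a \<Rightarrow> real. sum x A \<le> c}" for A c
    by (intro closed_Collect_le continuous_intros continuous_on_product_coordinates)
  then have "closed (\<Inter>A\<in>\<F>. {x. sum x A \<le> real (f A)})"
    by (intro closed_INT) blast
  moreover have "closed {x :: 'a \<Rightarrow> real. sum x E = real r}"
    by (intro closed_Collect_eq continuous_intros continuous_on_product_coordinates)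
  ultimately have "compact (PiE UNIV ?I \<inter> ({x. sum x E = real r} \<inter> (\<Inter>A\<in>\<F>. {x. sum x A \<le> real (f A)})))"
    by (intro compact_Int_closed closed_Int)
  also have "PiE UNIV ?I \<inter> ({x. sum x E = real r} \<inter> (\<Inter>A\<in>\<F>. {x. sum x A \<le> real (f A)}))
      = capped_polytope E r \<F> f"
  proof -
    have "x e \<in> ?I e \<longleftrightarrow> (e \<notin> E \<longrightarrow> x e = 0) \<and> (0 \<le> x e \<and> x e \<le> 1)" for x :: "'a \<Rightarrow> real" and e
      by auto
    then have "x \<in> PiE UNIV ?I \<longleftrightarrow> (\<forall>e. e \<notin> E \<longrightarrow> x e = 0) \<and> (\<forall>e. 0 \<le> x e \<and> x e \<le> 1)" for x
      by (simp only: PiE_UNIV_domain Pi_iff ball_UNIV all_conj_distrib)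
    then show ?thesis
      by (intro set_eqI) (simp add: capped_polytope_def hypersimplex_def)
  qed
  finally show ?thesis .
qed

context base_matroid
begin

text \<open>If all bases were lighter than \<open>t\<close>, the whole hull would lie in the convex
  open half-space below \<open>t\<close>.\<close>

lemma heavy_basis_iff:
  "base_polytope M \<inter> {x. t \<le> (\<Sum>e\<in>ground M. w e * x e)} \<noteq> {} \<longleftrightarrow> (\<exists>B\<in>bases M. t \<le> sum w B)"
  (is "?L \<longleftrightarrow> ?R")
proof
  have vertex: "(\<Sum>e\<in>ground M. w e * indicat_real B e) = sum w B" if "B \<in> bases M" for B
    using finite_ground basis_subset[OF that]
    by (simp add: indicator_def sum.If_cases if_distrib Int_absorb1 cong: if_cong)
  show ?R if ?L
  proof (rule ccontr)
    assume "\<not> ?R"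
    have "convex {x. (\<Sum>e\<in>ground M. w e * x e) < t}"
    proof (rule convexI)
      fix x y :: "'a \<Rightarrow> real" and u v :: real
      assume *: "x \<in> {x. (\<Sum>e\<in>ground M. w e * x e) < t}" "y \<in> {x. (\<Sum>e\<in>ground M. w e * x e) < t}"
        "0 \<le> u" "0 \<le> v" "u + v = 1"
      have "(\<Sum>e\<in>ground M. w e * (u *\<^sub>R x + v *\<^sub>R y) e) =
          u * (\<Sum>e\<in>ground M. w e * x e) + v * (\<Sum>e\<in>ground M. w e * y e)"
        by (simp add: scaleR_fun_def sum.distrib sum_distrib_left algebra_simps)
      also have "\<dots> < t" using * by (intro convex_bound_lt) auto
      finally show "u *\<^sub>R x + v *\<^sub>R y \<in> {x. (\<Sum>e\<in>ground M. w e * x e) < t}" by simp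
    qed
    then have "base_polytope M \<subseteq> {x. (\<Sum>e\<in>ground M. w e * x e) < t}"
      unfolding base_polytope_def
      using \<open>\<not> ?R\<close> vertex by (intro hull_minimal) (auto simp: not_le)
    then show False using \<open>?L\<close> by force
  qed
  show ?L if ?R
  proof -
    obtain B where B: "B \<in> bases M" "t \<le> sum w B" using \<open>?R\<close> by blast
    then have "indicat_real B \<in> base_polytope M"
      unfolding base_polytope_def by (intro hull_inc) simp
    then show ?thesis using B vertex by auto
  qed
qed

lemma sum_indicat_basis: "B \<in> bases M \<Longrightarrow> sum (indicat_real A) B = real (card (B \<inter> A))"
  using finite_basis[of B] by (simp add: sum_indicat_real Int_commute)

end

text \<open>A half-space section of a base polytope is compact and convex, with Euler characteristic
  1 if some basis is heavy enough and 0 otherwise. Linear relations between indicator functions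
  therefore pass to these truth values.\<close>

lemma basis_weight_valuation:
  fixes N :: "'i \<Rightarrow> 'a matroid" and a :: "'i \<Rightarrow> real" and w :: "'a \<Rightarrow> real"
  assumes J: "finite J" and N: "\<And>i. i \<in> J \<Longrightarrow> is_matroid (N i) \<and> ground (N i) = E"
    and E: "finite E"
    and zero: "\<And>x. (\<Sum>i\<in>J. a i * indicat_real (base_polytope (N i)) x) = 0"
  shows "(\<Sum>i\<in>J. a i * of_bool (\<exists>B\<in>bases (N i). t \<le> sum w B)) = 0"
proof -
  let ?H = "{x. t \<le> (\<Sum>e\<in>E. w e * x e)}"
  have poly: "base_polytope (N i) =
      capped_polytope E (matroid_rank (N i)) (Pow E) (rank_of (N i))" if "i \<in> J" for i
    using base_matroid.base_polytope_eq[of "N i"] N[OF that] by (simp add: base_matroid_def)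
  have "(\<Sum>i\<in>J. a i * of_bool (base_polytope (N i) \<inter> ?H \<noteq> {})) = 0"
  proof (rule euler_characteristic[of E, where z = "\<lambda>_. 0"])
    fix i assume i: "i \<in> J"
    have "closed ?H"
      by (intro closed_Collect_le continuous_intros continuous_on_product_coordinates)
    moreover have "convex ?H"
    proof (rule convexI)
      fix x y :: "'a \<Rightarrow> real" and u v :: real
      assume *: "x \<in> ?H" "y \<in> ?H" "0 \<le> u" "0 \<le> v" "u + v = 1"
      have "t = u * t + v * t" using *(5) by (simp flip: distrib_right)
      also have "\<dots> \<le> u * (\<Sum>e\<in>E. w e * x e) + v * (\<Sum>e\<in>E. w e * y e)"
        using * by (intro add_mono mult_left_mono) auto
      also have "\<dots> = (\<Sum>e\<in>E. w e * (u *\<^sub>R x + v *\<^sub>R y) e)"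
        by (simp add: scaleR_fun_def sum.distrib sum_distrib_left algebra_simps)
      finally show "u *\<^sub>R x + v *\<^sub>R y \<in> ?H" by simp
    qed
    ultimately show "compact (base_polytope (N i) \<inter> ?H) \<and> convex (base_polytope (N i) \<inter> ?H)"
      unfolding poly[OF i]
      by (simp add: compact_Int_closed compact_capped_polytope convex_Int convex_capped_polytope)
    fix x e assume "x \<in> base_polytope (N i) \<inter> ?H" "e \<notin> E"
    then show "x e = 0" unfolding poly[OF i] by (simp add: capped_polytope_def hypersimplex_def)
  next
    fix x
    have "indicat_real (base_polytope (N i) \<inter> ?H) x =
        indicat_real (base_polytope (N i)) x * indicat_real ?H x" for i
      by (simp add: indicator_def)
    then have "(\<Sum>i\<in>J. a i * indicat_real (base_polytope (N i) \<inter> ?H) x) =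
        (\<Sum>i\<in>J. a i * indicat_real (base_polytope (N i)) x) * indicat_real ?H x"
      by (simp only: sum_distrib_right mult.assoc)
    then show "(\<Sum>i\<in>J. a i * indicat_real (base_polytope (N i) \<inter> ?H) x) = 0"
      using zero by simp
  qed (use J E in auto)
  also have "(\<Sum>i\<in>J. a i * of_bool (base_polytope (N i) \<inter> ?H \<noteq> {})) =
      (\<Sum>i\<in>J. a i * of_bool (\<exists>B\<in>bases (N i). t \<le> sum w B))"
  proof (rule sum.cong[OF refl])
    fix i assume i: "i \<in> J"
    have "base_polytope (N i) \<inter> ?H \<noteq> {} \<longleftrightarrow> (\<exists>B\<in>bases (N i). t \<le> sum w B)"
      using base_matroid.heavy_basis_iff[of "N i" t w] N[OF i] by (simp add: base_matroid_def)
    then show "a i * of_bool (base_polytope (N i) \<inter> ?H \<noteq> {}) =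
        a i * of_bool (\<exists>B\<in>bases (N i). t \<le> sum w B)" by (simp only:)
  qed
  finally show ?thesis .
qed

lemma digits_unique:
  fixes d d' :: "nat \<Rightarrow> nat"
  assumes "\<And>j. j < m \<Longrightarrow> d j < N \<and> d' j < N" "(\<Sum>j<m. N ^ j * d j) = (\<Sum>j<m. N ^ j * d' j)" "j < m"
  shows "d j = d' j"
  using assms
proof (induction m arbitrary: d d' j)
  case (Suc m)
  have shift: "(\<Sum>j<Suc m. N ^ j * g j) = g 0 + N * (\<Sum>j<m. N ^ j * g (Suc j))" for g :: "nat \<Rightarrow> nat"
    by (simp only: sum.lessThan_Suc_shift) (simp add: sum_distrib_left mult.assoc)
  have N: "d 0 < N" "d' 0 < N" using Suc.prems(1)[of 0] by auto
  have eq: "d 0 + N * (\<Sum>j<m. N ^ j * d (Suc j)) = d' 0 + N * (\<Sum>j<m. N ^ j * d' (Suc j))"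
    using Suc.prems(2) unfolding shift .
  have "d 0 = d' 0" using arg_cong[OF eq, of "\<lambda>k. k mod N"] N by simp
  moreover have "(\<Sum>j<m. N ^ j * d (Suc j)) = (\<Sum>j<m. N ^ j * d' (Suc j))"
    using arg_cong[OF eq, of "\<lambda>k. k div N"] N by simp
  then have "d (Suc i) = d' (Suc i)" if "i < m" for i
    using Suc.IH[of "\<lambda>j. d (Suc j)" "\<lambda>j. d' (Suc j)" i] Suc.prems(1) that by simp
  ultimately show ?case using Suc.prems(3) by (cases j) auto
qed simp

lemma matroids_base_matroid: "M \<in> matroids r n \<Longrightarrow> base_matroid M"
  by (simp add: matroids_def base_matroid_def)

lemma matroid_eqI: "M \<in> matroids r n \<Longrightarrow> N \<in> matroids r n \<Longrightarrow> bases M = bases N \<Longrightarrow> M = N"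
  by (simp add: matroids_def matroid.expand)

text \<open>
  Among the Schubert matroids with nonzero coefficient take one, \<open>S\<close>, with the fewest bases. The
  weight is the maximum over the polytope of a linear functional which encodes the ranks of the
  cyclic flats of \<open>S\<close> as digits. A matroid of the same weight as \<open>S\<close> satisfies all the
  inequalities defining \<open>S\<close>, so it is \<open>S\<close> or has fewer bases.
\<close>

theorem schubert_indicators_independent:
  fixes b :: "nat matroid \<Rightarrow> real"
  assumes zero: "\<And>x. (\<Sum>S\<in>schuberts r n. b S * indicat_real (base_polytope S) x) = 0"
    and T: "T \<in> schuberts r n"
  shows "b T = 0"
proof (rule ccontr)
  assume "b T \<noteq> 0"
  then obtain S where S: "S \<in> schuberts r n" "b S \<noteq> 0"
    and S_min: "\<And>S'. S' \<in> schuberts r n \<Longrightarrow> b S' \<noteq> 0 \<Longrightarrow> card (bases S) \<le> card (bases S')"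
    using ex_has_least_nat[of "\<lambda>S. S \<in> schuberts r n \<and> b S \<noteq> 0" T "\<lambda>S. card (bases S)"] T by blast
  have mats: "S' \<in> matroids r n" if "S' \<in> schuberts r n" for S' using that by (simp add: schuberts_def)
  interpret S: base_matroid S using matroids_base_matroid mats S(1) by blast
  have ground: "ground S' = {1..n}" if "S' \<in> schuberts r n" for S'
    using mats[OF that] by (simp add: matroids_def)
  \<comment> \<open>The chain of cyclic flats is indexed by size, with repetitions at sizes that do
    not occur; then \<open>A (card Z) = Z\<close> for each cyclic flat \<open>Z\<close>.\<close>
  define A where "A j = \<Union>{Z \<in> cyclic_flats S. card Z \<le> j}" for j
  have A_mono: "A i \<subseteq> A j" if "i \<le> j" for i j using that by (auto simp: A_def)
  have A_sub: "A j \<subseteq> {1..n}" for j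
    using S.cyclic_flats_subset ground[OF S(1)] unfolding A_def by blast
  have A_card: "A (card Z) = Z" if Z: "Z \<in> cyclic_flats S" for Z
  proof -
    have finZ: "finite Z" using S.cyclic_flats_subset[OF Z] S.finite_ground finite_subset by blast
    have "Z' \<subseteq> Z" if "Z' \<in> cyclic_flats S" "card Z' \<le> card Z" for Z'
    proof -
      have "finite Z'" using S.cyclic_flats_subset[OF that(1)] S.finite_ground finite_subset by blast
      moreover have "Z \<subseteq> Z' \<or> Z' \<subseteq> Z" using S(1) Z that(1) by (auto simp: schuberts_def schubert_def)
      ultimately show ?thesis using card_seteq[of Z' Z] that(2) by blast
    qed
    then show ?thesis using Z unfolding A_def by blast
  qed
  \<comment> \<open>Base \<open>Suc n\<close> exceeds every rank, so the ranks can be read off as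
    digits. As the \<open>A j\<close> are nested, one basis attains all their ranks, which makes
    \<open>wt S'\<close> the maximal basis weight.\<close>
  define w where "w e = (\<Sum>j<Suc n. real (Suc n ^ j) * indicat_real (A j) e)" for e
  define wt where "wt S' = (\<Sum>j<Suc n. Suc n ^ j * rank_of S' (A j))" for S'
  have w_basis: "sum w B = real (\<Sum>j<Suc n. Suc n ^ j * card (B \<inter> A j))" if "finite B" for B
  proof -
    have "sum w B = (\<Sum>j<Suc n. \<Sum>e\<in>B. real (Suc n ^ j) * indicat_real (A j) e)"
      unfolding w_def by (rule sum.swap)
    also have "\<dots> = (\<Sum>j<Suc n. real (Suc n ^ j) * real (card (B \<inter> A j)))"
      using sum_indicat_real[OF that] by (simp only: Int_commute flip: sum_distrib_left)
    finally show ?thesis by (simp only: of_nat_sum of_nat_mult)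
  qed
  have heavy: "(\<exists>B\<in>bases S'. real t \<le> sum w B) \<longleftrightarrow> t \<le> wt S'" if S': "S' \<in> schuberts r n" for S' t
  proof -
    interpret S': base_matroid S' using matroids_base_matroid mats S' by blast
    show ?thesis
    proof
      assume "\<exists>B\<in>bases S'. real t \<le> sum w B"
      then obtain B where B: "B \<in> bases S'" "real t \<le> sum w B" by blast
      then have "t \<le> (\<Sum>j<Suc n. Suc n ^ j * card (B \<inter> A j))"
        using w_basis[OF S'.finite_basis[OF B(1)]] by (simp only: of_nat_le_iff)
      also have "\<dots> \<le> wt S'"
        unfolding wt_def by (intro sum_mono mult_left_mono S'.card_basis_Int_le B) simp
      finally show "t \<le> wt S'" .
    next
      assume t: "t \<le> wt S'"
      obtain B where B: "B \<in> bases S'" "\<forall>Z\<in>A ` {..<Suc n}. card (B \<inter> Z) = rank_of S' Z"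
      proof (rule bexE[OF S'.chain_adapted_basis[of "A ` {..<Suc n}"]])
        fix Y Z assume "Y \<in> A ` {..<Suc n}" "Z \<in> A ` {..<Suc n}"
        then show "Y \<subseteq> Z \<or> Z \<subseteq> Y" using A_mono nat_le_linear by (metis imageE)
      qed (use A_sub ground[OF S'] in auto)
      then have "wt S' = (\<Sum>j<Suc n. Suc n ^ j * card (B \<inter> A j))"
        unfolding wt_def by (intro sum.cong) auto
      then show "\<exists>B\<in>bases S'. real t \<le> sum w B"
        using B(1) t w_basis[OF S'.finite_basis[OF B(1)]] by (intro bexI[of _ B]) (simp_all only: of_nat_le_iff)
    qed
  qed
  have "(\<Sum>S'\<in>schuberts r n. b S' * of_bool (t \<le> wt S')) = 0" for t
  proof -
    have "(\<Sum>S'\<in>schuberts r n. b S' * of_bool (\<exists>B\<in>bases S'. real t \<le> sum w B)) = 0"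
      using basis_weight_valuation[of "schuberts r n" "\<lambda>S. S" "{1..n}" b "real t" w]
        zero finite_schuberts ground mats by (simp add: matroids_def)
    then show ?thesis using heavy by (simp cong: sum.cong)
  qed
  note wt_ge = this
  \<comment> \<open>Subtracting two consecutive integer thresholds isolates the matroids of weight
    exactly \<open>wt S\<close>.\<close>
  have "(\<Sum>S'\<in>schuberts r n. b S' * of_bool (wt S' = wt S)) =
      (\<Sum>S'\<in>schuberts r n. b S' * of_bool (wt S \<le> wt S') - b S' * of_bool (Suc (wt S) \<le> wt S'))"
    by (intro sum.cong) auto
  also have "\<dots> = 0" unfolding sum_subtractf wt_ge by simp
  finally have "(\<Sum>S'\<in>schuberts r n. b S' * of_bool (wt S' = wt S)) = 0" .
  moreover have "S' = S" if S': "S' \<in> schuberts r n" "b S' \<noteq> 0" "wt S' = wt S" for S'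
  proof -
    interpret S': base_matroid S' using matroids_base_matroid mats S' by blast
    have small: "rank_of N (A j) < Suc n" if "N \<in> schuberts r n" for N j
    proof -
      have "base_matroid N" using matroids_base_matroid mats that by blast
      then have "rank_of N (A j) \<le> card (A j)"
        using A_sub finite_subset by (intro base_matroid.rank_le_card) blast+
      also have "\<dots> \<le> card {1..n}" by (intro card_mono A_sub) simp
      finally show ?thesis by simp
    qed
    have digits: "rank_of S' (A j) = rank_of S (A j)" if "j < Suc n" for j
      using digits_unique[of "Suc n" "\<lambda>j. rank_of S' (A j)" "Suc n" "\<lambda>j. rank_of S (A j)" j]
        S'(3) small[OF S'(1)] small[OF S(1)] that unfolding wt_def by blast
    have "bases S' \<subseteq> bases S"
    proof
      fix B assume B: "B \<in> bases S'"
      show "B \<in> bases S"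
      proof (rule S.basis_if_cyclic_flats)
        show "B \<subseteq> ground S" using S'.basis_subset[OF B] ground S S' by simp
        show "card B = matroid_rank S"
          using S'.card_basis[OF B] mats[OF S(1)] mats[OF S'(1)] by (simp add: matroids_def)
        fix Z assume Z: "Z \<in> cyclic_flats S"
        have "card Z \<le> card {1..n}"
          using S.cyclic_flats_subset[OF Z] ground[OF S(1)] by (intro card_mono) auto
        then have "rank_of S' Z = rank_of S Z" using digits[of "card Z"] A_card[OF Z] by simp
        then show "card (B \<inter> Z) \<le> rank_of S Z" using S'.card_basis_Int_le[OF B, of Z] by simp
      qed
    qed
    moreover have "finite (bases S)"
      by (rule finite_subset[of _ "Pow (ground S)"]) (use S.basis_subset S.finite_ground in auto)
    ultimately have "bases S' = bases S" using S_min[OF S'(1,2)] card_seteq by blast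
    then show ?thesis using matroid_eqI mats S S' by blast
  qed
  then have "(\<Sum>S'\<in>schuberts r n. b S' * of_bool (wt S' = wt S)) = (\<Sum>S'\<in>schuberts r n. if S' = S then b S else 0)"
    by (intro sum.cong) auto
  then have "(\<Sum>S'\<in>schuberts r n. b S' * of_bool (wt S' = wt S)) = b S"
    using finite_schuberts S(1) by simp
  ultimately show False using S(2) by simp
qed

section \<open>The Schubert coefficients and their valuations\<close>

definition is_expansion :: "nat \<Rightarrow> nat \<Rightarrow> nat matroid \<Rightarrow> (nat matroid \<Rightarrow> int) \<Rightarrow> bool" where
  "is_expansion r n M a \<longleftrightarrow> (\<forall>S. S \<notin> schuberts r n \<longrightarrow> a S = 0) \<and>
     (\<forall>x. indicat_real (base_polytope M) x =
        (\<Sum>S\<in>schuberts r n. of_int (a S) * indicat_real (base_polytope S) x))"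

lemma is_expansion_unique:
  assumes a: "is_expansion r n M a" and b: "is_expansion r n M b"
  shows "a = b"
proof
  fix T
  show "a T = b T"
  proof (cases "T \<in> schuberts r n")
    case True
    have "(\<Sum>S\<in>schuberts r n. real_of_int (a S - b S) * indicat_real (base_polytope S) x) = 0" for x
    proof -
      have "(\<Sum>S\<in>schuberts r n. of_int (a S) * indicat_real (base_polytope S) x) =
          (\<Sum>S\<in>schuberts r n. of_int (b S) * indicat_real (base_polytope S) x)"
        using a b unfolding is_expansion_def by metis
      then show ?thesis by (simp add: left_diff_distrib sum_subtractf)
    qed
    then have "real_of_int (a T - b T) = 0"
      using True by (rule schubert_indicators_independent)
    then show ?thesis by simp
  next
    case False
    then show ?thesis using a b by (simp add: is_expansion_def)
  qed
qed

lemma schubert_coeff_eqI: "is_expansion r n M a \<Longrightarrow> schubert_coeff r n M = a"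
  unfolding schubert_coeff_def is_expansion_def[symmetric]
  using is_expansion_unique by blast

lemma schubert_coeff_expansion: "M \<in> matroids r n \<Longrightarrow> is_expansion r n M (schubert_coeff r n M)"
  using schubert_expansion_exists[of M r n] schubert_coeff_eqI[of r n M]
  unfolding is_expansion_def[symmetric] by metis

lemma schubert_coeff_weight:
  fixes w :: "nat \<Rightarrow> real"
  assumes M: "M \<in> matroids r n"
  shows "of_bool (\<exists>B\<in>bases M. t \<le> sum w B) =
    (\<Sum>S\<in>schuberts r n. real_of_int (schubert_coeff r n M S) * of_bool (\<exists>B\<in>bases S. t \<le> sum w B))"
proof -
  let ?a = "schubert_coeff r n M"
  have mats: "S \<in> matroids r n" if "S \<in> schuberts r n" for S using that by (simp add: schuberts_def)
  \<comment> \<open>Indices in the option type keep \<open>M\<close>, with coefficient -1, apart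
    from the Schubert matroids even if \<open>M\<close> is one of them.\<close>
  have J: "(\<Sum>i\<in>insert None (Some ` schuberts r n). g i) = g None + (\<Sum>S\<in>schuberts r n. g (Some S))"
    for g :: "nat matroid option \<Rightarrow> real"
    using finite_schuberts by (simp add: sum.reindex)
  have "(\<Sum>i\<in>insert None (Some ` schuberts r n). case_option (-1) (\<lambda>S. real_of_int (?a S)) i *
      of_bool (\<exists>B\<in>bases (case_option M (\<lambda>S. S) i). t \<le> sum w B)) = 0"
  proof (rule basis_weight_valuation[where N = "case_option M (\<lambda>S. S)" and E = "{1..n}"])
    fix i assume "i \<in> insert None (Some ` schuberts r n)"
    then show "is_matroid (case_option M (\<lambda>S. S) i) \<and> ground (case_option M (\<lambda>S. S) i) = {1..n}"
      using M mats by (auto simp: matroids_def)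
  next
    fix x
    show "(\<Sum>i\<in>insert None (Some ` schuberts r n). case_option (-1) (\<lambda>S. real_of_int (?a S)) i *
        indicat_real (base_polytope (case_option M (\<lambda>S. S) i)) x) = 0"
      using schubert_coeff_expansion[OF M] unfolding J is_expansion_def by simp
  qed (simp_all add: finite_schuberts)
  then show ?thesis unfolding J by simp
qed

section \<open>Linear functionals on class points\<close>

lemma isomorphic_refl: "isomorphic M M"
  unfolding isomorphic_def by (intro exI[of _ id]) auto

lemma isomorphic_sym:
  assumes "is_matroid M" "isomorphic M N"
  shows "isomorphic N M"
proof -
  obtain f where f: "bij_betw f (ground M) (ground N)" and b: "bases N = (\<lambda>B. f ` B) ` bases M"
    using assms(2) unfolding isomorphic_def by blast
  have "inv_into (ground M) f ` f ` B = B" if "B \<in> bases M" for B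
    using base_matroid.basis_subset[of M B] assms(1) that bij_betw_imp_inj_on[OF f]
    by (simp add: base_matroid_def inv_into_image_cancel)
  then have "bases M = (\<lambda>B. inv_into (ground M) f ` B) ` bases N"
    unfolding b by (simp add: image_image)
  then show ?thesis
    unfolding isomorphic_def using bij_betw_inv_into[OF f] by blast
qed

lemma isomorphic_trans:
  assumes "isomorphic M N" "isomorphic N L"
  shows "isomorphic M L"
proof -
  obtain f g where "bij_betw f (ground M) (ground N)" "bases N = (\<lambda>B. f ` B) ` bases M"
    and "bij_betw g (ground N) (ground L)" "bases L = (\<lambda>B. g ` B) ` bases N"
    using assms unfolding isomorphic_def by blast
  then have "bij_betw (g \<circ> f) (ground M) (ground L)" "bases L = (\<lambda>B. (g \<circ> f) ` B) ` bases M"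
    by (auto intro: bij_betw_trans simp: image_image image_comp)
  then show ?thesis unfolding isomorphic_def by blast
qed

lemma equiv_iso_rel: "equiv (matroids r n) (iso_rel r n)"
proof (rule equivI)
  show "iso_rel r n \<subseteq> matroids r n \<times> matroids r n" by (auto simp: iso_rel_def)
  show "refl_on (matroids r n) (iso_rel r n)"
    by (auto simp: refl_on_def iso_rel_def isomorphic_refl)
  show "sym (iso_rel r n)"
    by (auto simp: sym_def iso_rel_def matroids_def intro: isomorphic_sym)
  show "trans (iso_rel r n)"
    by (auto simp: trans_def iso_rel_def intro: isomorphic_trans)
qed

text \<open>Some basis meets \<open>X\<close> in at least \<open>t\<close> elements exactly when
  \<open>X\<close> has rank at least \<open>t\<close>; so \<open>j = t\<close> counts independent
  sets, and \<open>t\<close> equal to the rank counts spanning sets. Running over all sets of size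
  \<open>j\<close> makes the number isomorphism invariant.\<close>

definition count_meeting :: "nat \<Rightarrow> nat \<Rightarrow> 'a matroid \<Rightarrow> nat" where
  "count_meeting j t M =
     card {X. X \<subseteq> ground M \<and> card X = j \<and> (\<exists>B\<in>bases M. t \<le> card (B \<inter> X))}"

lemma count_meeting_le:
  assumes "is_matroid M" "is_matroid N" "isomorphic M N"
  shows "count_meeting j t M \<le> count_meeting j t N"
proof -
  obtain f where f: "bij_betw f (ground M) (ground N)" and b: "bases N = (\<lambda>B. f ` B) ` bases M"
    using assms(3) unfolding isomorphic_def by blast
  have inj: "inj_on f (ground M)" using f by (rule bij_betw_imp_inj_on)
  have sub: "B \<subseteq> ground M" if "B \<in> bases M" for B
    using base_matroid.basis_subset[of M B] assms(1) that by (simp add: base_matroid_def)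
  have card_im: "card (f ` X) = card X" if "X \<subseteq> ground M" for X
    by (rule card_image[OF inj_on_subset[OF inj that]])
  have meet: "card (f ` B \<inter> f ` X) = card (B \<inter> X)" if "B \<in> bases M" "X \<subseteq> ground M" for B X
  proof -
    have "f ` B \<inter> f ` X = f ` (B \<inter> X)" using inj_on_image_Int[OF inj sub[OF that(1)] that(2)] by simp
    then show ?thesis using card_im[of "B \<inter> X"] that(2) by (simp add: le_infI2)
  qed
  show ?thesis
    unfolding count_meeting_def
  proof (rule card_inj_on_le[of "(`) f"])
    show "inj_on ((`) f) {X. X \<subseteq> ground M \<and> card X = j \<and> (\<exists>B\<in>bases M. t \<le> card (B \<inter> X))}"
      by (rule inj_on_subset[OF inj_on_image_Pow[OF inj]]) auto
    show "(`) f ` {X. X \<subseteq> ground M \<and> card X = j \<and> (\<exists>B\<in>bases M. t \<le> card (B \<inter> X))}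
        \<subseteq> {X. X \<subseteq> ground N \<and> card X = j \<and> (\<exists>B\<in>bases N. t \<le> card (B \<inter> X))}"
    proof (rule image_subsetI)
      fix X assume "X \<in> {X. X \<subseteq> ground M \<and> card X = j \<and> (\<exists>B\<in>bases M. t \<le> card (B \<inter> X))}"
      then obtain B where X: "X \<subseteq> ground M" "card X = j" and B: "B \<in> bases M" "t \<le> card (B \<inter> X)"
        by blast
      have "f ` X \<subseteq> ground N" using X(1) f by (auto simp: bij_betw_def)
      moreover have "f ` B \<in> bases N" unfolding b using B(1) by (rule imageI)
      ultimately show "f ` X \<in> {X. X \<subseteq> ground N \<and> card X = j \<and> (\<exists>B\<in>bases N. t \<le> card (B \<inter> X))}"
        using card_im[OF X(1)] X(2) meet[OF B(1) X(1)] B(2) by (metis (mono_tags, lifting) mem_Collect_eq)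
    qed
    have "finite (Pow (ground N))" using assms(2) by (simp add: is_matroid_def)
    then show "finite {X. X \<subseteq> ground N \<and> card X = j \<and> (\<exists>B\<in>bases N. t \<le> card (B \<inter> X))}"
      by (rule rev_finite_subset) auto
  qed
qed

lemma count_meeting_isomorphic:
  "\<lbrakk>is_matroid M; is_matroid N; isomorphic M N\<rbrakk> \<Longrightarrow> count_meeting j t M = count_meeting j t N"
  by (rule antisym[OF count_meeting_le count_meeting_le[OF _ _ isomorphic_sym]])

lemma count_meeting_sum:
  assumes "M \<in> matroids r n"
  shows "real (count_meeting j t M) =
    (\<Sum>X\<in>{X. X \<subseteq> {1..n} \<and> card X = j}. of_bool (\<exists>B\<in>bases M. real t \<le> sum (indicat_real X) B))"
proof -
  interpret base_matroid M using assms by (rule matroids_base_matroid)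
  have fin: "finite {X. X \<subseteq> {1..n} \<and> card X = j}"
    by (rule finite_subset[of _ "Pow {1..n}"]) auto
  have "{X. X \<subseteq> ground M \<and> card X = j \<and> (\<exists>B\<in>bases M. t \<le> card (B \<inter> X))} =
      {X. X \<subseteq> {1..n} \<and> card X = j} \<inter> {X. \<exists>B\<in>bases M. real t \<le> sum (indicat_real X) B}"
    using assms by (auto simp: matroids_def sum_indicat_basis)
  then show ?thesis
    unfolding count_meeting_def
    by (simp only: sum_of_bool_eq[OF fin fin])
qed

lemma count_meeting_expansion:
  assumes M: "M \<in> matroids r n"
  shows "real (count_meeting j t M) =
    (\<Sum>S\<in>schuberts r n. real_of_int (schubert_coeff r n M S) * real (count_meeting j t S))"
proof -
  let ?X = "{X. X \<subseteq> {1..n} \<and> card X = j}"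
  have "real (count_meeting j t M) = (\<Sum>X\<in>?X. \<Sum>S\<in>schuberts r n.
      real_of_int (schubert_coeff r n M S) * of_bool (\<exists>B\<in>bases S. real t \<le> sum (indicat_real X) B))"
    unfolding count_meeting_sum[OF M] by (rule sum.cong[OF refl schubert_coeff_weight[OF M]])
  also have "\<dots> = (\<Sum>S\<in>schuberts r n. \<Sum>X\<in>?X.
      real_of_int (schubert_coeff r n M S) * of_bool (\<exists>B\<in>bases S. real t \<le> sum (indicat_real X) B))"
    by (rule sum.swap)
  also have "\<dots> = (\<Sum>S\<in>schuberts r n. real_of_int (schubert_coeff r n M S) * real (count_meeting j t S))"
  proof (rule sum.cong[OF refl])
    fix S assume "S \<in> schuberts r n"
    then have "S \<in> matroids r n" by (simp add: schuberts_def)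
    then show "(\<Sum>X\<in>?X. real_of_int (schubert_coeff r n M S) *
          of_bool (\<exists>B\<in>bases S. real t \<le> sum (indicat_real X) B)) =
        real_of_int (schubert_coeff r n M S) * real (count_meeting j t S)"
      by (simp only: count_meeting_sum[OF \<open>S \<in> matroids r n\<close>] sum_distrib_left)
  qed
  finally show ?thesis .
qed

text \<open>The factor is taken at an arbitrary representative of the class, since the count is
  constant on isomorphism classes.\<close>

definition count_functional :: "nat \<Rightarrow> nat \<Rightarrow> nat \<Rightarrow> nat \<Rightarrow> (nat matroid set \<Rightarrow> real) \<Rightarrow> real" where
  "count_functional r n j t p =
     (\<Sum>c\<in>schubert_classes r n. real (count_meeting j t (SOME S. S \<in> c)) * p c)"

lemma linear_count_functional: "linear (count_functional r n j t)"
  unfolding count_functional_def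
  by (rule linearI) (simp_all add: scaleR_fun_def sum.distrib sum_distrib_left algebra_simps)

lemma schubert_classes_quotient: "schubert_classes r n \<subseteq> matroids r n // iso_rel r n"
  unfolding schubert_classes_def quotient_def schuberts_def by blast

lemma class_subset: "c \<in> schubert_classes r n \<Longrightarrow> c \<subseteq> matroids r n"
  using schubert_classes_quotient in_quotient_imp_subset[OF equiv_iso_rel] by blast

lemma finite_class: "c \<in> schubert_classes r n \<Longrightarrow> finite c"
  using class_subset finite_matroids by (rule finite_subset)

lemma count_functional_class_point:
  assumes M: "M \<in> matroids r n"
  shows "count_functional r n j t (class_point r n M) = real (count_meeting j t M)"
proof -
  let ?C = "schubert_classes r n"
  let ?g = "\<lambda>S. real_of_int (schubert_coeff r n M S) * real (count_meeting j t S)"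
  have "count_functional r n j t (class_point r n M) = (\<Sum>c\<in>?C. \<Sum>S\<in>c. ?g S)"
    unfolding count_functional_def
  proof (rule sum.cong[OF refl])
    fix c assume c: "c \<in> ?C"
    have same: "count_meeting j t (SOME S. S \<in> c) = count_meeting j t S" if "S \<in> c" for S
    proof -
      have some: "(SOME S. S \<in> c) \<in> c" using that by (rule someI)
      have "((SOME S. S \<in> c), S) \<in> iso_rel r n"
        using in_quotient_imp_in_rel[OF equiv_iso_rel] c schubert_classes_quotient some that by blast
      then show ?thesis
        unfolding iso_rel_def matroids_def by (intro count_meeting_isomorphic) auto
    qed
    have "real (count_meeting j t (SOME S. S \<in> c)) * class_point r n M c =
        (\<Sum>S\<in>c. real (count_meeting j t (SOME S. S \<in> c)) * real_of_int (schubert_coeff r n M S))"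
      using c by (simp add: class_point_def sum_distrib_left)
    also have "\<dots> = (\<Sum>S\<in>c. ?g S)"
      by (rule sum.cong[OF refl]) (simp only: same mult.commute)
    finally show "real (count_meeting j t (SOME S. S \<in> c)) * class_point r n M c = (\<Sum>S\<in>c. ?g S)" .
  qed
  also have "\<dots> = (\<Sum>S\<in>\<Union>?C. ?g S)"
  proof (rule sum.Union_disjoint[symmetric, unfolded comp_def])
    show "\<forall>c\<in>?C. finite c" using finite_class by blast
    show "\<forall>c\<in>?C. \<forall>c'\<in>?C. c \<noteq> c' \<longrightarrow> c \<inter> c' = {}"
      using quotient_disj[OF equiv_iso_rel] schubert_classes_quotient by blast
  qed
  \<comment> \<open>Classes consist of all matroids isomorphic to a given Schubert matroid; outside
    \<open>schuberts r n\<close> the coefficients vanish by the convention in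
    \<open>schubert_coeff\<close>.\<close>
  also have "\<dots> = (\<Sum>S\<in>schuberts r n. ?g S)"
  proof (rule sum.mono_neutral_right)
    show "finite (\<Union>?C)"
      by (rule finite_subset[OF _ finite_matroids]) (use class_subset in blast)
    show "schuberts r n \<subseteq> \<Union>?C"
    proof
      fix S assume S: "S \<in> schuberts r n"
      then have "S \<in> iso_rel r n `` {S}"
        by (simp add: iso_rel_def isomorphic_refl schuberts_def)
      then show "S \<in> \<Union>?C" using S quotientI unfolding schubert_classes_def by fast
    qed
    show "\<forall>S\<in>\<Union>?C - schuberts r n. ?g S = 0"
      using schubert_coeff_expansion[OF M] by (simp add: is_expansion_def)
  qed
  also have "\<dots> = real (count_meeting j t M)" by (rule count_meeting_expansion[OF M, symmetric])
  finally show ?thesis .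
qed

text \<open>The points strictly below the maximum, together with \<open>p\<close>, form a convex
  set, which thus contains the whole hull. So \<open>p\<close> is the only maximiser in the hull,
  and no open segment of the hull contains it.\<close>

lemma exposed_extreme_point:
  fixes L :: "'v::real_vector \<Rightarrow> real"
  assumes L: "linear L" and p: "p \<in> G"
    and le: "\<And>g. g \<in> G \<Longrightarrow> L g \<le> L p" and eq: "\<And>g. g \<in> G \<Longrightarrow> L g = L p \<Longrightarrow> g = p"
  shows "p extreme_point_of convex hull G"
proof -
  let ?K = "{y. L y < L p \<or> y = p}"
  have comb: "L (u *\<^sub>R x + v *\<^sub>R y) = u * L x + v * L y" for u v x y
    using L by (simp add: linear_add linear_scale)
  have K_le: "L y \<le> L p" if "y \<in> ?K" for y using that by auto
  have strict: "L (u *\<^sub>R x + v *\<^sub>R y) < L p"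
    if "x \<in> ?K" "y \<in> ?K" "0 < u" "0 < v" "u + v = 1" "x \<noteq> p \<or> y \<noteq> p" for x y u v
  proof -
    have "u * L x + v * L y < u * L p + v * L p"
    proof (cases "x = p")
      case True
      then have "L y < L p" using that by auto
      then show ?thesis using that K_le[OF that(1)] by (intro add_le_less_mono) auto
    next
      case False
      then have "L x < L p" using that by auto
      then show ?thesis using that K_le[OF that(2)] by (intro add_less_le_mono) auto
    qed
    also have "\<dots> = L p" using that(5) by (simp flip: distrib_right)
    finally show ?thesis unfolding comb .
  qed
  have "convex ?K"
  proof (rule convexI)
    fix x y and u v :: real
    assume *: "x \<in> ?K" "y \<in> ?K" "0 \<le> u" "0 \<le> v" "u + v = 1"
    consider "u = 0" | "v = 0" | "0 < u" "0 < v" using * by linarith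
    then show "u *\<^sub>R x + v *\<^sub>R y \<in> ?K"
    proof cases
      case 3
      show ?thesis
      proof (cases "x = p \<and> y = p")
        case True
        then show ?thesis using *(5) by (simp flip: scaleR_add_left)
      next
        case False
        then show ?thesis using strict[OF *(1,2) 3 *(5)] by simp
      qed
    qed (use * in auto)
  qed
  moreover have "G \<subseteq> ?K" using le eq by (auto simp: order_less_le)
  ultimately have hull: "convex hull G \<subseteq> ?K" by (simp add: hull_minimal)
  show ?thesis
    unfolding extreme_point_of_def
  proof (intro conjI ballI notI)
    show "p \<in> convex hull G" using p by (rule hull_inc)
    fix a b assume ab: "a \<in> convex hull G" "b \<in> convex hull G" and "p \<in> open_segment a b"
    then obtain u where u: "a \<noteq> b" "0 < u" "u < 1" "p = (1 - u) *\<^sub>R a + u *\<^sub>R b"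
      by (auto simp: in_segment)
    have "L ((1 - u) *\<^sub>R a + u *\<^sub>R b) < L p"
      using ab hull u by (intro strict) auto
    then show False using u(4) by simp
  qed
qed

section \<open>Sparse paving matroids\<close>

context
  fixes r n :: nat and M :: "nat matroid"
  assumes M: "M \<in> matroids r n"
begin

interpretation base_matroid M using M by (rule matroids_base_matroid)

lemma ground_rank: "ground M = {1..n}" "matroid_rank M = r"
  using M by (simp_all add: matroids_def)

text \<open>Complementation turns paving of the dual, a condition on sets of size
  \<open>n - r - 1\<close>, into a spanning condition on sets of size \<open>r + 1\<close>.\<close>

lemma sparse_paving_iff:
  "sparse_paving M \<longleftrightarrow>
    (\<forall>X. X \<subseteq> {1..n} \<and> card X + 1 = r \<longrightarrow> indep M X) \<and>
    (\<forall>Y. Y \<subseteq> {1..n} \<and> card Y = r + 1 \<longrightarrow> (\<exists>B\<in>bases M. B \<subseteq> Y))"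
proof -
  interpret D: base_matroid "dual M" using dual_is_matroid by unfold_locales
  have gD: "ground (dual M) = {1..n}" by (simp add: dual_def ground_rank)
  obtain B where B: "B \<in> bases M" using bases_nonempty by blast
  have cB: "card B = r" "B \<subseteq> {1..n}" using card_basis[OF B] basis_subset[OF B] ground_rank by auto
  then have rn: "r \<le> n" using card_mono[of "{1..n}" B] by simp
  have "{1..n} - B \<in> bases (dual M)" using B by (simp add: dual_def ground_rank)
  then have rD: "matroid_rank (dual M) = n - r"
    using D.card_basis cB by (metis card_Diff_subset card_atLeastAtMost diff_Suc_1 finite_atLeastAtMost finite_subset)
  have indD: "indep (dual M) X \<longleftrightarrow> (\<exists>B\<in>bases M. X \<subseteq> {1..n} - B)" for X
    by (simp add: indep_def dual_def ground_rank)
  have "(\<forall>X. X \<subseteq> {1..n} \<and> card X + 1 = n - r \<longrightarrow> indep (dual M) X) \<longleftrightarrow>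
      (\<forall>Y. Y \<subseteq> {1..n} \<and> card Y = r + 1 \<longrightarrow> (\<exists>B\<in>bases M. B \<subseteq> Y))" (is "?L \<longleftrightarrow> ?R")
  proof (intro iffI allI impI)
    fix Y assume L: ?L and Y: "Y \<subseteq> {1..n} \<and> card Y = r + 1"
    have "card ({1..n} - Y) = n - (r + 1)"
      using Y card_Diff_subset[of Y "{1..n}"] finite_subset[of Y "{1..n}"] by simp
    moreover have "r + 1 \<le> n" using Y card_mono[of "{1..n}" Y] by simp
    ultimately have "indep (dual M) ({1..n} - Y)" using L by simp
    then obtain B where "B \<in> bases M" "{1..n} - Y \<subseteq> {1..n} - B" using indD by blast
    moreover have "B \<subseteq> {1..n}" using basis_subset[OF \<open>B \<in> bases M\<close>] ground_rank by simp
    ultimately show "\<exists>B\<in>bases M. B \<subseteq> Y" by blast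
  next
    fix X assume R: ?R and X: "X \<subseteq> {1..n} \<and> card X + 1 = n - r"
    have "card ({1..n} - X) = r + 1"
      using X card_Diff_subset[of X "{1..n}"] finite_subset[of X "{1..n}"] by simp linarith
    then obtain B where "B \<in> bases M" "B \<subseteq> {1..n} - X" using R by blast
    then show "indep (dual M) X" unfolding indD using X by blast
  qed
  then show ?thesis
    unfolding sparse_paving_def paving_def rD gD ground_rank
    using matroid dual_is_matroid by simp
qed

lemma count_subsets:
  "count_meeting j t M = card {X \<in> {X. X \<subseteq> {1..n} \<and> card X = j}. \<exists>B\<in>bases M. t \<le> card (B \<inter> X)}"
  unfolding count_meeting_def ground_rank by (simp add: conj_assoc)

lemma finite_subsets: "finite {X. X \<subseteq> {1..n} \<and> card X = j}"
  by (rule finite_subset[of _ "Pow {1..n}"]) auto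

lemma count_le: "count_meeting j t M \<le> card {X. X \<subseteq> {1..n} \<and> card X = j}"
  unfolding count_subsets using finite_subsets by (intro card_mono) auto

lemma count_eq_iff: "count_meeting j t M = card {X. X \<subseteq> {1..n} \<and> card X = j} \<longleftrightarrow>
    (\<forall>X. X \<subseteq> {1..n} \<and> card X = j \<longrightarrow> (\<exists>B\<in>bases M. t \<le> card (B \<inter> X)))"
proof
  assume "count_meeting j t M = card {X. X \<subseteq> {1..n} \<and> card X = j}"
  then have "{X \<in> {X. X \<subseteq> {1..n} \<and> card X = j}. \<exists>B\<in>bases M. t \<le> card (B \<inter> X)} = {X. X \<subseteq> {1..n} \<and> card X = j}"
    unfolding count_subsets using finite_subsets by (intro card_subset_eq) auto
  then show "\<forall>X. X \<subseteq> {1..n} \<and> card X = j \<longrightarrow> (\<exists>B\<in>bases M. t \<le> card (B \<inter> X))" by blast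
next
  assume "\<forall>X. X \<subseteq> {1..n} \<and> card X = j \<longrightarrow> (\<exists>B\<in>bases M. t \<le> card (B \<inter> X))"
  then have "{X \<in> {X. X \<subseteq> {1..n} \<and> card X = j}. \<exists>B\<in>bases M. t \<le> card (B \<inter> X)} = {X. X \<subseteq> {1..n} \<and> card X = j}"
    by blast
  then show "count_meeting j t M = card {X. X \<subseteq> {1..n} \<and> card X = j}"
    unfolding count_subsets by (simp only:)
qed

lemma card_Int_ge_left: "B \<in> bases M \<Longrightarrow> r \<le> card (B \<inter> X) \<longleftrightarrow> B \<subseteq> X"
proof -
  assume B: "B \<in> bases M"
  have "card B = r" "finite B" using card_basis[OF B] finite_basis[OF B] ground_rank by auto
  then have "r \<le> card (B \<inter> X) \<longleftrightarrow> B \<inter> X = B" using card_seteq[of B "B \<inter> X"] by auto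
  then show ?thesis by blast
qed

lemma card_Int_ge_right: "finite X \<Longrightarrow> card X \<le> card (B \<inter> X) \<longleftrightarrow> X \<subseteq> B"
  using card_seteq[of X "B \<inter> X"] by (metis Int_lower2 inf.absorb_iff2 order_refl)

lemma sparse_paving_iff_counts:
  "sparse_paving M \<longleftrightarrow>
    count_meeting (r - 1) (r - 1) M = card {X. X \<subseteq> {1..n} \<and> card X = r - 1} \<and>
    count_meeting (r + 1) r M = card {X. X \<subseteq> {1..n} \<and> card X = r + 1}"
proof -
  have "(\<forall>X. X \<subseteq> {1..n} \<and> card X = r - 1 \<longrightarrow> (\<exists>B\<in>bases M. r - 1 \<le> card (B \<inter> X))) \<longleftrightarrow>
      (\<forall>X. X \<subseteq> {1..n} \<and> card X + 1 = r \<longrightarrow> indep M X)"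
  \<comment> \<open>For \<open>r = 0\<close> the truncated \<open>r - 1\<close> is 0: the condition
    on the left holds trivially and the paving condition is void.\<close>
  proof (cases "r = 0")
    case True
    then show ?thesis using bases_nonempty by auto
  next
    case False
    have "(\<exists>B\<in>bases M. r - 1 \<le> card (B \<inter> X)) \<longleftrightarrow> indep M X" if "X \<subseteq> {1..n}" "card X = r - 1" for X
      using card_Int_ge_right[of X] that finite_subset[OF that(1)] unfolding indep_def by simp
    then show ?thesis using False by auto
  qed
  then show ?thesis
    unfolding sparse_paving_iff count_eq_iff using card_Int_ge_left by simp
qed

lemma basis_iff_meeting:
  assumes "X \<subseteq> {1..n}" "card X = r"
  shows "(\<exists>B\<in>bases M. r \<le> card (B \<inter> X)) \<longleftrightarrow> X \<in> bases M"
proof -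
  have fin: "finite X" using assms finite_subset by blast
  have "X = B" if "B \<in> bases M" "B \<subseteq> X" for B
    using card_subset_eq[OF fin that(2)] card_basis[OF that(1)] ground_rank assms by simp
  then show ?thesis using card_Int_ge_left by auto
qed

lemma card_nonbases:
  "card (nonbases r n M) + count_meeting r r M = card {X. X \<subseteq> {1..n} \<and> card X = r}"
proof -
  let ?X = "{X. X \<subseteq> {1..n} \<and> card X = r}"
  have "{X \<in> ?X. \<exists>B\<in>bases M. r \<le> card (B \<inter> X)} = {X \<in> ?X. X \<in> bases M}"
    using basis_iff_meeting by blast
  also have "\<dots> = ?X - nonbases r n M" by (auto simp: nonbases_def)
  also have "card \<dots> = card ?X - card (nonbases r n M)"
    using finite_subset[OF _ finite_subsets[of r]] by (intro card_Diff_subset) (auto simp: nonbases_def)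
  finally have "count_meeting r r M = card ?X - card (nonbases r n M)" unfolding count_subsets .
  moreover have "card (nonbases r n M) \<le> card ?X"
    by (rule card_mono[OF finite_subsets]) (auto simp: nonbases_def)
  ultimately show ?thesis by simp
qed

lemma finite_nonbases: "finite (nonbases r n M)"
  unfolding nonbases_def by (rule finite_subset[OF _ finite_subsets[of r]]) auto

lemma uniform_if_no_nonbases:
  assumes "nonbases r n M = {}"
  shows "M = uniform r n"
proof -
  have "bases M = {B. B \<subseteq> {1..n} \<and> card B = r}"
    using assms basis_subset card_basis ground_rank unfolding nonbases_def by blast
  then show ?thesis by (simp add: uniform_def matroid.expand ground_rank)
qed

end

context
  fixes r n :: nat and M :: "nat matroid"
  assumes M: "M \<in> matroids r n" and sp: "sparse_paving M"
begin

interpretation base_matroid M using M by (rule matroids_base_matroid)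

lemma indep_small:
  assumes "X \<subseteq> {1..n}" "card X < r" shows "indep M X"
proof -
  obtain B where B: "B \<in> bases M" using bases_nonempty by blast
  have "r \<le> card {1..n}"
    using card_mono[of "{1..n}" B] basis_subset[OF B] card_basis[OF B] ground_rank[OF M] by simp
  then have "card X \<le> r - 1" "r - 1 \<le> card {1..n}" using assms(2) by simp_all
  from exists_subset_between[OF this assms(1) finite_atLeastAtMost]
  obtain Y where Y: "X \<subseteq> Y" "Y \<subseteq> {1..n}" "card Y = r - 1" by blast
  then have "indep M Y" using sp assms(2) unfolding sparse_paving_iff[OF M] by simp
  then show ?thesis using Y(1) by (rule indep_subset)
qed

lemma rank_large:
  assumes "X \<subseteq> {1..n}" "r < card X" shows "rank_of M X = r"
proof -
  obtain Y where Y: "Y \<subseteq> X" "card Y = r + 1"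
    using obtain_subset_with_card_n[of "r + 1" X] assms(2) by auto
  then obtain B where "B \<in> bases M" "B \<subseteq> Y"
    using sp assms(1) unfolding sparse_paving_iff[OF M] by (meson subset_trans)
  then have "card B \<le> rank_of M X" using Y(1) by (intro card_le_rank indep_basis) auto
  then show ?thesis
    using card_basis[OF \<open>B \<in> bases M\<close>] rank_le_matroid_rank[of X] ground_rank[OF M] by simp
qed

lemma rank_nonbasis:
  assumes H: "H \<in> nonbases r n M" shows "rank_of M H = r - 1" "r > 0"
proof -
  have H': "H \<subseteq> {1..n}" "card H = r" "H \<notin> bases M" using H by (auto simp: nonbases_def)
  have fin: "finite H" using H'(1) finite_subset by blast
  have "\<not> indep M H" using H' basis_iff_indep ground_rank[OF M] by simp
  then have lt: "rank_of M H < r" using indep_iff_rank[OF fin] H'(2) by simp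
  then show "r > 0" by simp
  obtain X where X: "X \<subseteq> H" "card X = r - 1"
    using obtain_subset_with_card_n[of "r - 1" H] H'(2) by auto
  then have "indep M X" using H'(1) \<open>r > 0\<close> by (intro indep_small) auto
  then have "card X \<le> rank_of M H" using X(1) by (intro card_le_rank)
  then show "rank_of M H = r - 1" using lt X(2) by simp
qed

text \<open>\<open>H \<union> H'\<close> has more than \<open>r\<close> elements, hence rank
  \<open>r\<close>, and the smaller set \<open>H \<inter> H'\<close> is independent; submodularity
  gives \<open>r + card (H \<inter> H') \<le> 2 * (r - 1)\<close>.\<close>

lemma card_Int_nonbases:
  assumes H: "H \<in> nonbases r n M" and H': "H' \<in> nonbases r n M" and "H \<noteq> H'"
  shows "card (H \<inter> H') + 2 \<le> r"
proof (rule ccontr)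
  assume large: "\<not> ?thesis"
  have sub: "H \<subseteq> {1..n}" "H' \<subseteq> {1..n}" and c: "card H = r" "card H' = r"
    using H H' by (auto simp: nonbases_def)
  have fin: "finite H" "finite H'" using sub finite_subset by auto
  have lt: "card (H \<inter> H') < r"
  proof (rule ccontr)
    assume "\<not> ?thesis"
    then have "H \<inter> H' = H" "H \<inter> H' = H'"
      using fin c card_seteq[of H "H \<inter> H'"] card_seteq[of H' "H \<inter> H'"] by auto
    then show False using \<open>H \<noteq> H'\<close> by simp
  qed
  have "card (H \<union> H') + card (H \<inter> H') = 2 * r" using card_Un_Int[OF fin] c by simp
  then have "r < card (H \<union> H')" using lt by simp
  then have "rank_of M (H \<union> H') = r" using sub by (intro rank_large) auto
  moreover have "rank_of M (H \<inter> H') = card (H \<inter> H')"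
    using lt sub by (intro rank_indep indep_small) auto
  moreover have "rank_of M (H \<union> H') + rank_of M (H \<inter> H') \<le> rank_of M H + rank_of M H'"
    using sub ground_rank[OF M] by (intro rank_submodular) auto
  ultimately show False using rank_nonbasis[OF H] rank_nonbasis[OF H'] large by simp
qed

text \<open>Sets of size below \<open>r\<close> are independent, so \<open>x e \<le> 1\<close> gives
  their rank inequality; bases and larger sets have rank \<open>r\<close>, which is the total
  weight. Only nonbases impose anything beyond the hypersimplex.\<close>

lemma in_polytope_iff:
  assumes x: "x \<in> hypersimplex {1..n} r"
  shows "x \<in> base_polytope M \<longleftrightarrow> (\<forall>H\<in>nonbases r n M. sum x H \<le> real (r - 1))"
proof -
  have xb: "0 \<le> x e" "x e \<le> 1" for e using x by (auto simp: hypersimplex_def)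
  have sumE: "sum x {1..n} = real r" using x by (simp add: hypersimplex_def)
  have le_r: "sum x A \<le> real r" if "A \<subseteq> {1..n}" for A
    using sum_mono2[of "{1..n}" A x] that xb sumE by simp
  have le_card: "sum x A \<le> real (card A)" for A
    using sum_bounded_above[of A x 1] xb by simp
  have "x \<in> base_polytope M \<longleftrightarrow> (\<forall>A\<in>Pow {1..n}. sum x A \<le> real (rank_of M A))"
    using x unfolding base_polytope_eq capped_polytope_def ground_rank[OF M] by simp
  also have "\<dots> \<longleftrightarrow> (\<forall>H\<in>nonbases r n M. sum x H \<le> real (r - 1))"
  proof
    assume "\<forall>A\<in>Pow {1..n}. sum x A \<le> real (rank_of M A)"
    moreover have "H \<in> Pow {1..n}" if "H \<in> nonbases r n M" for H using that by (simp add: nonbases_def)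
    ultimately show "\<forall>H\<in>nonbases r n M. sum x H \<le> real (r - 1)"
      using rank_nonbasis(1) by metis
  next
    assume H: "\<forall>H\<in>nonbases r n M. sum x H \<le> real (r - 1)"
    show "\<forall>A\<in>Pow {1..n}. sum x A \<le> real (rank_of M A)"
    proof
      fix A assume "A \<in> Pow {1..n}"
      then have A: "A \<subseteq> {1..n}" by simp
      consider "card A < r" | "card A = r" "A \<in> bases M" | "A \<in> nonbases r n M" | "r < card A"
        using A unfolding nonbases_def by (cases "card A" r rule: linorder_cases) blast+
      then show "sum x A \<le> real (rank_of M A)"
      proof cases
        case 1
        then show ?thesis using rank_indep[OF indep_small[OF A]] le_card[of A] by simp
      next
        case 2
        then show ?thesis using rank_indep[OF indep_basis] le_r[OF A] by simp
      next
        case 3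
        then show ?thesis using H rank_nonbasis(1) by simp
      next
        case 4
        then show ?thesis using rank_large[OF A] le_r[OF A] by simp
      qed
    qed
  qed
  finally show ?thesis .
qed

text \<open>Distinct nonbases cut disjoint corners off the hypersimplex.\<close>

lemma indicator_polytope:
  assumes x: "x \<in> hypersimplex {1..n} r"
  shows "indicat_real (base_polytope M) x =
    1 - real (card (nonbases r n M)) + (\<Sum>H\<in>nonbases r n M. of_bool (sum x H \<le> real (r - 1)))"
proof -
  let ?N = "nonbases r n M"
  define V where "V = {H \<in> ?N. \<not> sum x H \<le> real (r - 1)}"
  have finN: "finite ?N" by (rule finite_nonbases[OF M])
  \<comment> \<open>Two violated nonbases would give
    \<open>2 * (r - 1) < sum x H + sum x H' \<le> r + (r - 2)\<close>, the last bound coming from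
    union and intersection.\<close>
  have "card V \<le> 1"
  proof -
    have "H = H'" if "H \<in> V" "H' \<in> V" for H H'
    proof (rule ccontr)
      assume "H \<noteq> H'"
      have N: "H \<in> ?N" "H' \<in> ?N" and big: "real (r - 1) < sum x H" "real (r - 1) < sum x H'"
        using that by (auto simp: V_def)
      have sub: "H \<subseteq> {1..n}" "H' \<subseteq> {1..n}" using N by (auto simp: nonbases_def)
      have fin: "finite H" "finite H'" using sub finite_subset by auto
      have xb: "0 \<le> x e" "x e \<le> 1" for e using x by (auto simp: hypersimplex_def)
      have "sum x (H \<union> H') \<le> sum x {1..n}" using sub xb by (intro sum_mono2) auto
      then have "sum x (H \<union> H') \<le> real r" using x by (simp add: hypersimplex_def)
      moreover have "sum x (H \<inter> H') \<le> real (card (H \<inter> H'))"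
        using sum_bounded_above[of "H \<inter> H'" x 1] xb by simp
      moreover have "sum x (H \<union> H') + sum x (H \<inter> H') = sum x H + sum x H'"
        using fin by (rule sum.union_inter)
      moreover have "real (card (H \<inter> H')) \<le> real (r - 1) - 1"
        using card_Int_nonbases[OF N \<open>H \<noteq> H'\<close>] by (simp add: of_nat_diff)
      moreover have "real r = real (r - 1) + 1"
        using rank_nonbasis(2)[OF N(1)] by (simp add: of_nat_diff)
      ultimately show False using big by linarith
    qed
    then show ?thesis using card_le_Suc0_iff_eq[of V] finN by (simp add: V_def)
  qed
  have "(\<Sum>H\<in>?N. of_bool (sum x H \<le> real (r - 1)) :: real) = (\<Sum>H\<in>?N. 1 - of_bool (H \<in> V))"
    by (rule sum.cong[OF refl]) (auto simp: V_def)
  also have "\<dots> = real (card ?N) - real (card V)"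
  proof -
    have "?N \<inter> V = V" by (auto simp: V_def)
    then show ?thesis using finN by (simp add: sum_subtractf)
  qed
  finally have "1 - real (card ?N) + (\<Sum>H\<in>?N. of_bool (sum x H \<le> real (r - 1))) = 1 - real (card V)"
    by simp
  moreover have "indicat_real (base_polytope M) x = of_bool (V = {})"
    using in_polytope_iff[OF x] by (auto simp: V_def indicator_def)
  moreover have "finite V" using finN by (simp add: V_def)
  then have "of_bool (V = {}) = 1 - real (card V)"
    using \<open>card V \<le> 1\<close> by (cases "card V") auto
  ultimately show ?thesis by simp
qed

end

section \<open>Expansions by removing bases from the uniform matroid\<close>

abbreviation uniform_minus :: "nat \<Rightarrow> nat \<Rightarrow> nat set \<Rightarrow> nat matroid" where
  "uniform_minus r n H \<equiv> capped {1..n} r {H} (\<lambda>_. r - 1)"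

lemma capped_chain_in_schuberts: "capped_chain {1..n} r d k \<Longrightarrow> capped {1..n} r d k \<in> schuberts r n"
  unfolding schuberts_def matroids_def
  by (simp add: capped_chain.schubert_capped capped_chain.capped_is_matroid
      capped_chain.ground_capped capped_chain.rank_capped)

lemma uniform_capped: "uniform r n = capped {1..n} r {} k"
  by (simp add: uniform_def capped_def)

lemma uniform_chain: "r \<le> n \<Longrightarrow> capped_chain {1..n} r {} k"
proof
  assume "r \<le> n"
  then obtain B where "B \<subseteq> {1..n}" "card B = r"
    using obtain_subset_with_card_n[of r "{1..n}"] by auto
  then have "B \<in> bases (capped {1..n} r {} k)" by (simp add: capped_def)
  then show "bases (capped {1..n} r {} k) \<noteq> {}" by blast
qed auto

text \<open>The second set \<open>A\<close> serves twice: it is still a basis under the cap on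
  \<open>H\<close>, and it keeps \<open>H\<close> a proper subset of the ground set.\<close>

lemma uniform_minus_chain:
  fixes n :: nat
  assumes "A \<subseteq> {1..n}" "card A = r" "H \<subseteq> {1..n}" "card H = r" "A \<noteq> H"
  shows "capped_chain {1..n} r {H} (\<lambda>_. r - 1)"
proof
  have fin: "finite A" "finite H" using assms finite_subset by auto
  have "\<not> H \<subseteq> A" "\<not> A \<subseteq> H"
    using card_subset_eq[OF fin(1), of H] card_subset_eq[OF fin(2), of A] assms by auto
  then have "A \<inter> H \<subset> A" by blast
  then have "card (A \<inter> H) < r" using psubset_card_mono[OF fin(1)] assms(2) by blast
  then have "A \<in> bases (uniform_minus r n H)" using assms by (simp add: capped_def)
  then show "bases (uniform_minus r n H) \<noteq> {}" by blast
  show "Z \<subset> {1..n}" if "Z \<in> {H}" for Z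
    using that assms \<open>\<not> A \<subseteq> H\<close> by auto
qed auto

text \<open>Gluing a bijection from \<open>H\<close> to \<open>H'\<close> with one between the
  complements carries one cap to the other. Hence all matroids \<open>U - H\<close> lie in one class
  and contribute to a single coordinate.\<close>

lemma uniform_minus_isomorphic:
  assumes "H \<subseteq> {1..n}" "card H = r" "H' \<subseteq> {1..n}" "card H' = r"
  shows "isomorphic (uniform_minus r n H) (uniform_minus r n H')"
proof -
  have fin: "finite H" "finite H'" using assms finite_subset by auto
  obtain g where g: "bij_betw g H H'" using finite_same_card_bij[OF fin] assms by auto
  have "card ({1..n} - H) = card ({1..n} - H')" using assms fin by (simp add: card_Diff_subset)
  then obtain h where h: "bij_betw h ({1..n} - H) ({1..n} - H')"
    using finite_same_card_bij[of "{1..n} - H" "{1..n} - H'"] by auto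
  define f where "f e = (if e \<in> H then g e else h e)" for e
  have fH: "bij_betw f H H'" using g by (rule bij_betw_cong[THEN iffD1, rotated]) (simp add: f_def)
  have "bij_betw f ({1..n} - H) ({1..n} - H')"
    using h by (rule bij_betw_cong[THEN iffD1, rotated]) (simp add: f_def)
  from bij_betw_combine[OF fH this] have f: "bij_betw f {1..n} {1..n}"
    using assms by (simp add: Un_absorb1)
  have inj: "inj_on f {1..n}" using f by (rule bij_betw_imp_inj_on)
  have fH': "f ` H = H'" using fH by (rule bij_betw_imp_surj_on)
  have cards: "card (f ` B) = card B" "card (f ` B \<inter> H') = card (B \<inter> H)" if B: "B \<subseteq> {1..n}" for B
  proof -
    have im: "card (f ` X) = card X" if "X \<subseteq> {1..n}" for X
      by (rule card_image[OF inj_on_subset[OF inj that]])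
    show "card (f ` B) = card B" using B by (rule im)
    have "f ` B \<inter> H' = f ` (B \<inter> H)"
      unfolding fH'[symmetric] using inj_on_image_Int[OF inj B assms(1)] by simp
    then show "card (f ` B \<inter> H') = card (B \<inter> H)" using im[of "B \<inter> H"] B by (simp add: le_infI1)
  qed
  have "bases (uniform_minus r n H') = (\<lambda>B. f ` B) ` bases (uniform_minus r n H)"
  proof (intro equalityI subsetI)
    fix B' assume B': "B' \<in> bases (uniform_minus r n H')"
    then have "B' \<subseteq> f ` {1..n}" using bij_betw_imp_surj_on[OF f] by (simp add: capped_def)
    then obtain B where B: "B \<subseteq> {1..n}" "B' = f ` B" by (auto simp: subset_image_iff)
    then have "B \<in> bases (uniform_minus r n H)" using B' cards[OF B(1)] by (simp add: capped_def)
    then show "B' \<in> (\<lambda>B. f ` B) ` bases (uniform_minus r n H)" unfolding B(2) by (rule imageI)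
  next
    fix B' assume "B' \<in> (\<lambda>B. f ` B) ` bases (uniform_minus r n H)"
    then obtain B where B: "B' = f ` B" "B \<in> bases (uniform_minus r n H)" by (rule imageE)
    then have "B \<subseteq> {1..n}" by (simp add: capped_def)
    moreover have "f ` B \<subseteq> {1..n}" using calculation bij_betw_imp_surj_on[OF f] by blast
    ultimately show "B' \<in> bases (uniform_minus r n H')"
      using B cards[of B] by (simp add: capped_def)
  qed
  then show ?thesis unfolding isomorphic_def using f by (auto simp: capped_def)
qed

text \<open>By uniqueness it suffices to verify the displayed coefficients: off the hypersimplex
  every indicator vanishes, and on it \<open>indicator_polytope\<close> evaluates the left
  side.\<close>

lemma sparse_paving_expansion:
  assumes M: "M \<in> matroids r n" and sp: "sparse_paving M" and rn: "r \<le> n"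
  shows "schubert_coeff r n M = (\<lambda>S. (1 - int (card (nonbases r n M))) * of_bool (S = uniform r n) +
    (\<Sum>H\<in>nonbases r n M. of_bool (S = uniform_minus r n H)))"
proof (rule schubert_coeff_eqI)
  let ?N = "nonbases r n M" and ?a = "\<lambda>S. (1 - int (card (nonbases r n M))) * of_bool (S = uniform r n) +
    (\<Sum>H\<in>nonbases r n M. of_bool (S = uniform_minus r n H)) :: int"
  interpret base_matroid M using M by (rule matroids_base_matroid)
  obtain A where A: "A \<in> bases M" using bases_nonempty by blast
  have chain: "capped_chain {1..n} r {H} (\<lambda>_. r - 1)" if "H \<in> ?N" for H
    using that A basis_subset[OF A] card_basis[OF A] ground_rank[OF M]
    by (intro uniform_minus_chain[of A]) (auto simp: nonbases_def)
  have U: "uniform r n \<in> schuberts r n"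
    unfolding uniform_capped[where k = "\<lambda>_. 0"] by (rule capped_chain_in_schuberts[OF uniform_chain[OF rn]])
  have V: "uniform_minus r n H \<in> schuberts r n" if "H \<in> ?N" for H
    by (rule capped_chain_in_schuberts[OF chain[OF that]])
  have delta: "(\<Sum>S\<in>schuberts r n. of_bool (S = T) * g S) = g T" if "T \<in> schuberts r n"
    for T and g :: "nat matroid \<Rightarrow> real"
  proof -
    have "(\<Sum>S\<in>schuberts r n. of_bool (S = T) * g S) = (\<Sum>S\<in>schuberts r n. if S = T then g T else 0)"
      by (rule sum.cong) auto
    then show ?thesis using that finite_schuberts by simp
  qed
  show "is_expansion r n M ?a"
    unfolding is_expansion_def
  proof (intro conjI allI impI)
    fix S assume "S \<notin> schuberts r n"
    then have "S \<noteq> uniform r n" "\<forall>H\<in>?N. S \<noteq> uniform_minus r n H" using U V by auto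
    then show "?a S = 0" by simp
  next
    fix x :: "nat \<Rightarrow> real"
    let ?P = "\<lambda>S :: nat matroid. indicat_real (base_polytope S) x"
    have "(\<Sum>S\<in>schuberts r n. of_int (?a S) * ?P S) =
      (1 - real (card ?N)) * (\<Sum>S\<in>schuberts r n. of_bool (S = uniform r n) * ?P S) +
      (\<Sum>S\<in>schuberts r n. \<Sum>H\<in>?N. of_bool (S = uniform_minus r n H) * ?P S)"
      by (simp add: distrib_right sum.distrib sum_distrib_left sum_distrib_right mult.assoc)
    also have "(\<Sum>S\<in>schuberts r n. \<Sum>H\<in>?N. of_bool (S = uniform_minus r n H) * ?P S) =
      (\<Sum>H\<in>?N. \<Sum>S\<in>schuberts r n. of_bool (S = uniform_minus r n H) * ?P S)" by (rule sum.swap)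
    also have "\<dots> = (\<Sum>H\<in>?N. ?P (uniform_minus r n H))"
      by (rule sum.cong[OF refl delta[OF V]])
    finally have sum: "(\<Sum>S\<in>schuberts r n. of_int (?a S) * ?P S) =
      (1 - real (card ?N)) * ?P (uniform r n) + (\<Sum>H\<in>?N. ?P (uniform_minus r n H))"
      unfolding delta[OF U] .
    have PU: "base_polytope (uniform r n) = hypersimplex {1..n} r"
      unfolding uniform_capped[where k = "\<lambda>_. 0"] capped_chain.base_polytope_capped[OF uniform_chain[OF rn]]
      by (simp add: capped_polytope_def)
    have PV: "base_polytope (uniform_minus r n H) = {x \<in> hypersimplex {1..n} r. sum x H \<le> real (r - 1)}"
      if "H \<in> ?N" for H
      using capped_chain.base_polytope_capped[OF chain[OF that]] by (simp add: capped_polytope_def)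
    show "?P M = (\<Sum>S\<in>schuberts r n. of_int (?a S) * ?P S)"
    proof (cases "x \<in> hypersimplex {1..n} r")
      case True
      have "(\<Sum>H\<in>?N. ?P (uniform_minus r n H)) = (\<Sum>H\<in>?N. of_bool (sum x H \<le> real (r - 1)))"
        by (intro sum.cong refl, subst PV) (use True in \<open>simp_all add: indicator_def\<close>)
      then show ?thesis
        unfolding sum PU indicator_polytope[OF M sp True] using True by simp
    next
      case False
      have "x \<notin> base_polytope M"
        using False unfolding base_polytope_eq capped_polytope_def ground_rank[OF M] by simp
      moreover have "(\<Sum>H\<in>?N. ?P (uniform_minus r n H)) = 0"
        by (intro sum.neutral ballI, subst PV) (use False in simp_all)
      ultimately show ?thesis unfolding sum PU using False by simp
    qed
  qed
qed

text \<open>All terms \<open>U - H\<close> fall into one class, represented by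
  \<open>H = {1..r}\<close>, so the point depends only on the number of nonbases and is affine in
  it.\<close>

lemma sparse_paving_class_point:
  assumes M: "M \<in> matroids r n" and sp: "sparse_paving M" and rn: "r \<le> n"
  shows "class_point r n M = (\<lambda>c. of_bool (c \<in> schubert_classes r n) *
    ((1 - real (card (nonbases r n M))) * of_bool (uniform r n \<in> c) +
     real (card (nonbases r n M)) * of_bool (uniform_minus r n {1..r} \<in> c)))"
proof
  fix c
  let ?N = "nonbases r n M"
  show "class_point r n M c = of_bool (c \<in> schubert_classes r n) *
    ((1 - real (card ?N)) * of_bool (uniform r n \<in> c) +
     real (card ?N) * of_bool (uniform_minus r n {1..r} \<in> c))"
  proof (cases "c \<in> schubert_classes r n")
    case c: True
    interpret base_matroid M using M by (rule matroids_base_matroid)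
    have fin: "finite c" using c by (rule finite_class)
    have delta: "(\<Sum>S\<in>c. of_bool (S = T)) = (of_bool (T \<in> c) :: int)" for T
      using fin by (simp add: of_bool_def)
    have same: "uniform_minus r n H \<in> c \<longleftrightarrow> uniform_minus r n {1..r} \<in> c" if H: "H \<in> ?N" for H
    proof -
      have H': "H \<subseteq> {1..n}" "card H = r" using H by (auto simp: nonbases_def)
      have R: "{1..r} \<subseteq> {1..n}" "card {1..r} = r" using rn by auto
      obtain A where A: "A \<in> bases M" using bases_nonempty by blast
      have A': "A \<subseteq> {1..n}" "card A = r" "A \<noteq> H"
        using A H basis_subset[OF A] card_basis[OF A] ground_rank[OF M] by (auto simp: nonbases_def)
      \<comment> \<open>This needs an \<open>r\<close>-set other than \<open>{1..r}\<close>: the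
        basis \<open>A\<close> or the nonbasis \<open>H\<close> serves, as they differ.\<close>
      have "capped_chain {1..n} r {{1..r}} (\<lambda>_. r - 1)"
      proof (cases "A = {1..r}")
        case True
        then show ?thesis using uniform_minus_chain[OF H' R] A' by simp
      next
        case False
        then show ?thesis using uniform_minus_chain[OF A'(1,2) R] by simp
      qed
      then have mR: "uniform_minus r n {1..r} \<in> matroids r n"
        using capped_chain_in_schuberts by (simp add: schuberts_def)
      have mH: "uniform_minus r n H \<in> matroids r n"
        using capped_chain_in_schuberts[OF uniform_minus_chain[OF A'(1,2) H' A'(3)]]
        by (simp add: schuberts_def)
      have rel: "(uniform_minus r n H, uniform_minus r n {1..r}) \<in> iso_rel r n"
        "(uniform_minus r n {1..r}, uniform_minus r n H) \<in> iso_rel r n"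
        unfolding iso_rel_def using mR mH uniform_minus_isomorphic H' R by auto
      have "c \<in> matroids r n // iso_rel r n" using c schubert_classes_quotient by (rule rev_subsetD)
      then show ?thesis using in_quotient_imp_closed[OF equiv_iso_rel] rel by metis
    qed
    have "(\<Sum>S\<in>c. schubert_coeff r n M S) = (1 - int (card ?N)) * (\<Sum>S\<in>c. of_bool (S = uniform r n)) +
        (\<Sum>S\<in>c. \<Sum>H\<in>?N. of_bool (S = uniform_minus r n H))"
      unfolding sparse_paving_expansion[OF M sp rn] sum.distrib sum_distrib_left by (rule refl)
    also have "(\<Sum>S\<in>c. \<Sum>H\<in>?N. of_bool (S = uniform_minus r n H)) =
        (\<Sum>H\<in>?N. \<Sum>S\<in>c. of_bool (S = uniform_minus r n H) :: int)" by (rule sum.swap)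
    also have "\<dots> = (\<Sum>H\<in>?N. of_bool (uniform_minus r n {1..r} \<in> c))"
      by (rule sum.cong[OF refl]) (simp only: delta same)
    also have "\<dots> = int (card ?N) * of_bool (uniform_minus r n {1..r} \<in> c)" by (simp only: sum_constant)
    finally have "(\<Sum>S\<in>c. schubert_coeff r n M S) = (1 - int (card ?N)) * of_bool (uniform r n \<in> c) +
        int (card ?N) * of_bool (uniform_minus r n {1..r} \<in> c)" unfolding delta .
    then show ?thesis using c by (simp add: class_point_def)
  qed (simp add: class_point_def)
qed

section \<open>Extremality of sparse paving matroids\<close>

lemma uniform_sparse_paving:
  assumes "r \<le> n"
  shows "uniform r n \<in> matroids r n" "sparse_paving (uniform r n)" "nonbases r n (uniform r n) = {}"
proof -
  show U: "uniform r n \<in> matroids r n"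
    using capped_chain_in_schuberts[OF uniform_chain[OF assms, of "\<lambda>_. 0"]]
    unfolding uniform_capped[where k = "\<lambda>_. 0"] schuberts_def by blast
  show "nonbases r n (uniform r n) = {}" by (auto simp: nonbases_def uniform_def)
  show "sparse_paving (uniform r n)"
    unfolding sparse_paving_iff[OF U]
  proof (intro conjI allI impI)
    fix X assume X: "X \<subseteq> {1..n} \<and> card X + 1 = r"
    then obtain B where "X \<subseteq> B" "B \<subseteq> {1..n}" "card B = r"
      using exists_subset_between[of X r "{1..n}"] assms by auto
    then show "indep (uniform r n) X" unfolding indep_def uniform_def by auto
  next
    fix Y assume Y: "Y \<subseteq> {1..n} \<and> card Y = r + 1"
    then obtain B where "B \<subseteq> Y" "card B = r"
      using obtain_subset_with_card_n[of r Y] by auto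
    then show "\<exists>B\<in>bases (uniform r n). B \<subseteq> Y" using Y by (auto simp: uniform_def)
  qed
qed

lemma extremal_uniform:
  assumes "r \<le> n"
  shows "extremal r n (uniform r n)"
  unfolding extremal_def Omega_def
proof (rule exposed_extreme_point[OF linear_count_functional[of r n r r]])
  note U = uniform_sparse_paving[OF assms]
  show "class_point r n (uniform r n) \<in> class_point r n ` matroids r n" using U(1) by (rule imageI)
  have U_count: "count_meeting r r (uniform r n) = card {X. X \<subseteq> {1..n} \<and> card X = r}"
    using card_nonbases[OF U(1)] U(3) by simp
  fix g assume "g \<in> class_point r n ` matroids r n"
  then obtain N where N: "g = class_point r n N" "N \<in> matroids r n" by (rule imageE)
  show "count_functional r n r r g \<le> count_functional r n r r (class_point r n (uniform r n))"
    unfolding N(1) count_functional_class_point[OF N(2)] count_functional_class_point[OF U(1)] U_count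
    using card_nonbases[OF N(2)] by simp
  assume "count_functional r n r r g = count_functional r n r r (class_point r n (uniform r n))"
  then have "card (nonbases r n N) = 0"
    unfolding N(1) count_functional_class_point[OF N(2)] count_functional_class_point[OF U(1)] U_count
    using card_nonbases[OF N(2)] by simp
  then have "N = uniform r n"
    using finite_nonbases[OF N(2)] uniform_if_no_nonbases[OF N(2)] by simp
  then show "g = class_point r n (uniform r n)" by (simp add: N(1))
qed

text \<open>
  The exposing functional rewards independent \<open>(r - 1)\<close>-sets and spanning \<open>(r + 1)\<close>-sets so much
  that only sparse paving matroids compete, and among these it penalises bases.
\<close>

lemma extremal_max_nonbases:
  assumes rn: "r \<le> n" and M: "M \<in> matroids r n" and sp: "sparse_paving M"
    and max: "\<And>N. N \<in> matroids r n \<Longrightarrow> sparse_paving N \<Longrightarrow> card (nonbases r n N) \<le> card (nonbases r n M)"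
  shows "extremal r n M"
proof -
  define tot where "tot j = card {X. X \<subseteq> {1..n} \<and> card X = j}" for j
  \<comment> \<open>\<open>K\<close> exceeds the number of possible bases, so losing one independent
    \<open>(r - 1)\<close>-set or one spanning \<open>(r + 1)\<close>-set costs more than any change
    in the number of bases can recover.\<close>
  define K where "K = real (tot r) + 1"
  define L where "L p = K * (count_functional r n (r - 1) (r - 1) p + count_functional r n (r + 1) r p)
    - count_functional r n r r p" for p
  have lin: "linear L"
    unfolding L_def
    by (rule linearI) (simp_all add: linear_add[OF linear_count_functional]
        linear_scale[OF linear_count_functional] algebra_simps)
  have L: "L (class_point r n N) = K * real (count_meeting (r - 1) (r - 1) N + count_meeting (r + 1) r N)
      - real (count_meeting r r N)" if "N \<in> matroids r n" for N
    unfolding L_def by (simp add: count_functional_class_point[OF that])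
  have bases: "real (count_meeting r r N) = real (tot r) - real (card (nonbases r n N))"
    if "N \<in> matroids r n" for N
    using card_nonbases[OF that] unfolding tot_def by linarith
  have L_sp: "L (class_point r n N) = K * real (tot (r - 1) + tot (r + 1)) - real (tot r)
      + real (card (nonbases r n N))" if "N \<in> matroids r n" "sparse_paving N" for N
    using that(2) unfolding L[OF that(1)] bases[OF that(1)] sparse_paving_iff_counts[OF that(1)] tot_def
    by simp
  have L_not_sp: "L (class_point r n N) < L (class_point r n M)"
    if N: "N \<in> matroids r n" "\<not> sparse_paving N" for N
  proof -
    have "count_meeting (r - 1) (r - 1) N + count_meeting (r + 1) r N + 1 \<le> tot (r - 1) + tot (r + 1)"
      using N(2) count_le[OF N(1), of "r - 1" "r - 1"] count_le[OF N(1), of "r + 1" r]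
      unfolding sparse_paving_iff_counts[OF N(1)] tot_def by linarith
    then have "real (count_meeting (r - 1) (r - 1) N + count_meeting (r + 1) r N) + 1
        \<le> real (tot (r - 1) + tot (r + 1))"
      by (metis of_nat_1 of_nat_add of_nat_le_iff)
    then have "K * (real (count_meeting (r - 1) (r - 1) N + count_meeting (r + 1) r N) + 1)
        \<le> K * real (tot (r - 1) + tot (r + 1))"
      by (rule mult_left_mono) (simp add: K_def)
    then have "K * real (count_meeting (r - 1) (r - 1) N + count_meeting (r + 1) r N) + K
        \<le> K * real (tot (r - 1) + tot (r + 1))"
      by (simp only: distrib_left mult_1_right)
    then have "L (class_point r n N) + K \<le> K * real (tot (r - 1) + tot (r + 1))"
      unfolding L[OF N(1)] by simp
    then show ?thesis unfolding L_sp[OF M sp] K_def by linarith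
  qed
  show ?thesis
    unfolding extremal_def Omega_def
  proof (rule exposed_extreme_point[OF lin])
    show "class_point r n M \<in> class_point r n ` matroids r n" using M by (rule imageI)
    fix g assume "g \<in> class_point r n ` matroids r n"
    then obtain N where N: "g = class_point r n N" "N \<in> matroids r n" by (rule imageE)
    show "L g \<le> L (class_point r n M)"
    proof (cases "sparse_paving N")
      case True
      then show ?thesis unfolding N(1) L_sp[OF N(2) True] L_sp[OF M sp] using max[OF N(2) True] by simp
    next
      case False
      then show ?thesis unfolding N(1) using L_not_sp[OF N(2)] by simp
    qed
    assume eq: "L g = L (class_point r n M)"
    then have spN: "sparse_paving N" using L_not_sp[OF N(2)] unfolding N(1) by force
    have "card (nonbases r n N) = card (nonbases r n M)"
      using eq unfolding N(1) L_sp[OF N(2) spN] L_sp[OF M sp] by simp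
    \<comment> \<open>Equal numbers of nonbases give equal class points, so even non-isomorphic
      matroids attaining the maximum share one vertex.\<close>
    then show "g = class_point r n M"
      unfolding N(1) sparse_paving_class_point[OF N(2) spN rn] sparse_paving_class_point[OF M sp rn]
      by simp
  qed
qed

lemma not_extremal_between:
  assumes rn: "r \<le> n" and M: "M \<in> matroids r n" "sparse_paving M" and N: "N \<in> matroids r n" "sparse_paving N"
    and pos: "0 < card (nonbases r n M)" and less: "card (nonbases r n M) < card (nonbases r n N)"
  shows "\<not> extremal r n M"
proof
  assume ext: "extremal r n M"
  note U = uniform_sparse_paving[OF rn]
  \<comment> \<open>The points are affine in the number of nonbases, which is 0 at the uniform
    matroid; this ratio is the position of \<open>M\<close> on the segment towards
    \<open>N\<close>.\<close>
  define u where "u = real (card (nonbases r n M)) / real (card (nonbases r n N))"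
  have u: "0 < u" "u < 1" "u * real (card (nonbases r n N)) = real (card (nonbases r n M))"
    using pos less by (simp_all add: u_def)
  \<comment> \<open>An open segment needs distinct endpoints; the number of bases, a function of the
    class point, tells them apart.\<close>
  have "class_point r n (uniform r n) \<noteq> class_point r n N"
  proof
    assume "class_point r n (uniform r n) = class_point r n N"
    then have "count_meeting r r (uniform r n) = count_meeting r r N"
      using count_functional_class_point[OF U(1), of r r] count_functional_class_point[OF N(1), of r r] by simp
    then show False using card_nonbases[OF U(1)] card_nonbases[OF N(1)] U(3) pos less by simp
  qed
  moreover have "class_point r n M =
      (1 - u) *\<^sub>R class_point r n (uniform r n) + u *\<^sub>R class_point r n N"
    unfolding sparse_paving_class_point[OF M rn] sparse_paving_class_point[OF N rn]
      sparse_paving_class_point[OF U(1,2) rn] U(3) scaleR_fun_def u(3)[symmetric]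
    by (simp add: fun_eq_iff algebra_simps)
  ultimately have "class_point r n M \<in> open_segment (class_point r n (uniform r n)) (class_point r n N)"
    unfolding in_segment using u by blast
  moreover have "class_point r n N' \<in> Omega r n" if "N' \<in> matroids r n" for N'
    unfolding Omega_def using that by (intro hull_inc imageI)
  ultimately show False
    using ext U(1) N(1) unfolding extremal_def extreme_point_of_def by blast
qed

theorem theorem5p11:
  fixes r n :: nat and M :: "nat matroid"
  assumes "r \<le> n"
    and "M \<in> matroids r n"
    and "sparse_paving M"
  shows "extremal r n M \<longleftrightarrow>
    M = uniform r n \<or>
    (\<forall>N\<in>matroids r n. sparse_paving N \<longrightarrow> card (nonbases r n N) \<le> card (nonbases r n M))"
proof
  assume ext: "extremal r n M"
  show "M = uniform r n \<or>
    (\<forall>N\<in>matroids r n. sparse_paving N \<longrightarrow> card (nonbases r n N) \<le> card (nonbases r n M))"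
  proof (rule disjCI, rule ccontr)
    assume "\<not> (\<forall>N\<in>matroids r n. sparse_paving N \<longrightarrow> card (nonbases r n N) \<le> card (nonbases r n M))"
    then obtain N where N: "N \<in> matroids r n" "sparse_paving N"
      "card (nonbases r n M) < card (nonbases r n N)" by (auto simp: not_le)
    assume "M \<noteq> uniform r n"
    then have "0 < card (nonbases r n M)"
      using uniform_if_no_nonbases[OF assms(2)] finite_nonbases[OF assms(2)] by (auto simp: card_gt_0_iff)
    then show False using not_extremal_between[OF assms N(1,2) _ N(3)] ext by blast
  qed
next
  assume "M = uniform r n \<or>
    (\<forall>N\<in>matroids r n. sparse_paving N \<longrightarrow> card (nonbases r n N) \<le> card (nonbases r n M))"
  then show "extremal r n M"
  proof
    assume "M = uniform r n"
    then show ?thesis using extremal_uniform[OF assms(1)] by simp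
  next
    assume "\<forall>N\<in>matroids r n. sparse_paving N \<longrightarrow> card (nonbases r n N) \<le> card (nonbases r n M)"
    then show ?thesis using extremal_max_nonbases[OF assms] by blast
  qed
qed

end
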